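(* Suppose $(M_1,M_2)$ is a ghost-free pair of generalised tree modules over the zero-relation algebra $\Lambda=\mathcal K Q/\langle\rho\rangle$, where $\mathcal K$ is a field with $\mathrm{char}(\mathcal K)\neq 2$. Given a $\Lambda$-module homomorphism $\mathcal H:M_1\to M_2$, there exist finitely many scalars $\mu_1,\dots,\mu_N\in\mathcal K$ and generalised graph maps $\mathcal G_1,\dots,\mathcal G_N$ from $M_1$ to $M_2$ (with $N=0$, i.e. the empty sum, allowed) such that $$\mathcal H=\sum_{l=1}^N\mu_l\,\mathcal H_{\mathcal G_l}.$$
   Context: **Setting.** $\mathcal K$ is a field with $\mathrm{char}(\mathcal K)\neq 2$. $Q=(Q_0,Q_1)$ is a locally finite quiver, $\rho$ is a set of paths in $Q$ of length at least $2$ such that for each $v\in Q_0$ there is $n\ge 0$ such that $\langle\rho\rangle$ contains all paths of length exceeding $n$ with source or target $v$; $\Lambda:=\mathcal K Q/\langle\rho\rangle$ is called a zero-relation algebra. Finite-dimensional left $\Lambda$-modules are identified with finite-dimensional bound $\mathcal K$-representations of $(Q,\rho)$. A tree is a finite quiver $T=(T_0,T_1,s,t)$ whose underlying undirected graph is simply connected (a tree); $T_0\subset\mathbb N$. A bound quiver morphism $F:T\to(Q,\rho)$ is a quiver morphism $T\to Q$ such that no path $p$ in $T$ has $F(p)\in\langle\rho\rangle$. The associated generalised tree module $F_\lambda(V_T)$ is the $\Lambda$-module with $\mathcal K$-basis $\{v_n\mid n\in T_0\}$, where $v_n$ lies in the vector space at the vertex $F(n)$, and each arrow $\gamma\in Q_1$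 acts by $\gamma\cdot v_n=\sum_{a\in T_1,\ s(a)=n,\ F(a)=\gamma}v_{t(a)}$. Let $T^1,T^2$ be trees, $F_i:T^i\to(Q,\rho)$ bound quiver morphisms ($i=1,2$), $M_i:=(F_i)_\lambda(V_{T^i})$, with canonical bases $\{v_n\}_{n\in T^1_0}$ of $M_1$ and $\{w_m\}_{m\in T^2_0}$ of $M_2$. **Networks.** A network consists of a quiver together with a set of undirected edges forming a simple graph on the same vertex set. A subnetwork consists of subsets of the vertices, arrows and edges such that all endpoints of the chosen arrows and edges are chosen. It is connected if its underlying undirected graph is connected. A link between two vertices is an arrow (in either direction) or an edge joining them. The pullback network $\mathcal N[1]$ of $(M_1,M_2)$ has vertices $(n,m)\in T^1_0\times T^2_0$ with $F_1(n)=F_2(m)$; arrows $(n,m)\xrightarrow{(a,b)}(n',m')$ for arrows $n\xrightarrow{a}n'$ in $T^1$, $m\xrightarrow{b}m'$ in $T^2$ with $F_1(a)=F_2(b)$; and edge set $\mathcal E^1$ consisting of all $\{(n,m),(n',m)\}$ such that $n\neq n'$ and there are arrows $n\xleftarrow{a}n''\xrightarrow{b}n'$ in $T^1$ with $F_1(a)=F_1(b)$, and all $\{(n,m),(n,m')\}$ such that $m\ne m'$ and there are arrows $m\xrightarrow{c}m''\xleftarrow{d}m'$ in $T^2$ with $F_2(c)=F_2(d)$. The 2-covering network $\mathcal N[2]$ has vertices $(n,m,j)$ with $(n,m)\in\mathcal N[1]_0$, $j\in\{-1,1\}$; arrows $(n,m,j)\xrightarrow{(a,b,j)}(n',m',j)$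 for each arrow $(n,m)\xrightarrow{(a,b)}(n',m')$ of $\mathcal N[1]$ and $j\in\{-1,1\}$; and edges $\{(n,m,j),(n',m',-j)\}$ for each $\{(n,m),(n',m')\}\in\mathcal E^1$ and $j\in\{-1,1\}$. $\pi:\mathcal N[2]\to\mathcal N[1]$ denotes the projection forgetting the sign $j$. **Properties of a subnetwork $\mathcal M=(\mathcal M_0,\mathcal M_1,\mathcal E_{\mathcal M})$ (vertices, arrows, edges) of $\mathcal N[2]$.** *Complete*: for each $(n,m,j)\in\mathcal M_0$: (1) for every arrow $n'\xrightarrow{a}n$ in $T^1$, at least one of: (1a) there is $m'\xrightarrow{b}m$ in $T^2$ with $((n',m',j)\xrightarrow{(a,b,j)}(n,m,j))\in\mathcal M_1$; (1b) there are $n\xleftarrow{a}n'\xrightarrow{c}n''$ in $T^1$ with $F_1(a)=F_1(c)$ and $(n'',m,-j)\in\mathcal M_0$ such that $\{(n,m,j),(n'',m,-j)\}\in\mathcal E_{\mathcal M}$; (2) for every arrow $m\xrightarrow{b}m'$ in $T^2$, at least one of: (2a) there is $n\xrightarrow{a}n'$ in $T^1$ with $((n,m,j)\xrightarrow{(a,b,j)}(n',m',j))\in\mathcal M_1$; (2b) there are $m\xrightarrow{b}m'\xleftarrow{d}m''$ in $T^2$ with $F_2(b)=F_2(d)$ and $(n,m'',-j)\in\mathcal M_0$ such that $\{(n,m,j),(n,m'',-j)\}\in\mathcal E_{\mathcal M}$. *$\mathcal R[2]$-free*: there are no vertices $x,y,z$ of $\mathcal M$ such that $\mathcal M$ contains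 a link between $x$ and $y$ and a link between $y$ and $z$, and $\pi(x),\pi(y),\pi(z)$ are three distinct vertices of $\mathcal N[1]$ that are pairwise joined by links in $\mathcal N[1]$ (i.e. form a triangle). *Involution-free*: $(n,m,j)\in\mathcal M_0$ implies $(n,m,-j)\notin\mathcal M_0$. *Involution-invariant*: $\mathcal M_0=\pi^{-1}(\pi(\mathcal M_0))$. A *generalised graph map* from $M_1$ to $M_2$ is a non-empty connected involution-free complete $\mathcal R[2]$-free subnetwork $\mathcal G$ of $\mathcal N[2]$; the associated homomorphism $\mathcal H_{\mathcal G}:M_1\to M_2$ is the $\mathcal K$-linear map $\mathcal H_{\mathcal G}(v_n):=\sum_{(n,m,j)\in\mathcal G_0}j\,w_m$. A *ghost* is a non-empty connected involution-invariant complete $\mathcal R[2]$-free subnetwork of $\mathcal N[2]$. The pair $(M_1,M_2)$ is *ghost-free* if $\mathcal N[2]$ contains no ghost. *)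

theory Defs
  imports
    "Graph_Theory.Digraph_Component"
    "HOL-Library.Function_Algebras"
    "HOL-Computational_Algebra.Computational_Algebra"
begin

section \<open>Coordinate spaces\<close>

text \<open>All vector spaces over the field \<open>'k\<close> below are subspaces of a function space
  \<open>'i \<Rightarrow> 'k\<close>, with the pointwise operations of \<open>Function_Algebras\<close>.\<close>

definition scale_fun :: "'k::field \<Rightarrow> ('i \<Rightarrow> 'k) \<Rightarrow> ('i \<Rightarrow> 'k)" where
  "scale_fun c x = (\<lambda>i. c * x i)"

definition unit_vec :: "'i \<Rightarrow> ('i \<Rightarrow> 'k::field)" where
  "unit_vec i = (\<lambda>k. if k = i then 1 else 0)"

lemma scale_fun_apply [simp]: "scale_fun c x i = c * x i"
  by (simp add: scale_fun_def)

interpretation fun_vs: vector_space "scale_fun :: 'k::field \<Rightarrow> ('i \<Rightarrow> 'k) \<Rightarrow> ('i \<Rightarrow> 'k)"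
  by standard (simp_all add: fun_eq_iff algebra_simps)

section \<open>Path algebras and zero relations\<close>

text \<open>Quivers are the multidigraphs of \<open>Graph_Theory\<close>; arrows go from \<open>tail\<close> to \<open>head\<close>.
  A path is its source together with its arrows listed in the order in which they are
  traversed; the source is recorded so that there is a trivial path at every vertex.\<close>

type_synonym ('v, 'e) path = "'v \<times> 'e list"

definition paths :: "('v, 'e) pre_digraph \<Rightarrow> ('v, 'e) path set" where
  "paths Q = {(u, es). \<exists>v. pre_digraph.awalk Q u es v}"

definition path_source :: "('v, 'e) path \<Rightarrow> 'v" where
  "path_source p = fst p"

definition path_target :: "('v, 'e) pre_digraph \<Rightarrow> ('v, 'e) path \<Rightarrow> 'v" where
  "path_target Q p = pre_digraph.awlast Q (fst p) (snd p)"

definition path_length :: "('v, 'e) path \<Rightarrow> nat" where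
  "path_length p = length (snd p)"

text \<open>The underlying space of the path algebra; the path \<open>p\<close> is the element \<open>unit_vec p\<close>.\<close>

definition path_algebra :: "('v, 'e) pre_digraph \<Rightarrow> (('v, 'e) path \<Rightarrow> 'k::field) set" where
  "path_algebra Q = {x. finite {p. x p \<noteq> 0} \<and> {p. x p \<noteq> 0} \<subseteq> paths Q}"

text \<open>The product of paths \<open>p\<close> and \<open>q\<close> is ``first \<open>q\<close>, then \<open>p\<close>'', as is appropriate for left
  modules. The sum runs over all ways of cutting the path \<open>(u, es)\<close> in two.\<close>

definition path_mult :: "('v, 'e) pre_digraph \<Rightarrow>
    (('v, 'e) path \<Rightarrow> 'k::field) \<Rightarrow> (('v, 'e) path \<Rightarrow> 'k) \<Rightarrow> (('v, 'e) path \<Rightarrow> 'k)" where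
  "path_mult Q x y = (\<lambda>(u, es). \<Sum>i\<le>length es.
      x (path_target Q (u, take i es), drop i es) * y (u, take i es))"

definition two_sided_ideal :: "('v, 'e) pre_digraph \<Rightarrow> (('v, 'e) path \<Rightarrow> 'k::field) set \<Rightarrow> bool" where
  "two_sided_ideal Q I \<longleftrightarrow> I \<subseteq> path_algebra Q \<and> fun_vs.subspace I \<and>
     (\<forall>x\<in>path_algebra Q. \<forall>y\<in>I. path_mult Q x y \<in> I \<and> path_mult Q y x \<in> I)"

definition generated_ideal :: "('v, 'e) pre_digraph \<Rightarrow> ('v, 'e) path set \<Rightarrow>
    (('v, 'e) path \<Rightarrow> 'k::field) set" where
  "generated_ideal Q \<rho> = \<Inter>{I. two_sided_ideal Q I \<and> unit_vec ` \<rho> \<subseteq> I}"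

definition locally_finite :: "('v, 'e) pre_digraph \<Rightarrow> bool" where
  "locally_finite Q \<longleftrightarrow>
     (\<forall>v\<in>verts Q. finite {e \<in> arcs Q. tail Q e = v} \<and> finite {e \<in> arcs Q. head Q e = v})"

text \<open>The pair \<open>(Q, \<rho>)\<close> presents a zero-relation algebra over \<open>'k\<close>, namely the quotient of
  \<open>path_algebra Q\<close> by \<open>generated_ideal Q \<rho>\<close>. The field only enters as a type argument.\<close>

definition zero_relation_algebra ::
    "'k::field itself \<Rightarrow> ('v, 'e) pre_digraph \<Rightarrow> ('v, 'e) path set \<Rightarrow> bool" where
  "zero_relation_algebra K Q \<rho> \<longleftrightarrow>
     wf_digraph Q \<and> locally_finite Q \<and>
     \<rho> \<subseteq> paths Q \<and> (\<forall>p\<in>\<rho>. path_length p \<ge> 2) \<and>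
     (\<forall>v\<in>verts Q. \<exists>n. \<forall>p\<in>paths Q.
        path_length p > n \<and> (path_source p = v \<or> path_target Q p = v) \<longrightarrow>
        (unit_vec p :: ('v, 'e) path \<Rightarrow> 'k) \<in> generated_ideal Q \<rho>)"

section \<open>Bound representations\<close>

text \<open>A module over a zero-relation algebra is given by its spaces at the vertices, which
  are independent subspaces of the ambient space, and by the actions of the arrows; the
  module itself is the (internal) direct sum of the spaces at the vertices.\<close>

record ('v, 'e, 'm) quiver_rep =
  vspace :: "'v \<Rightarrow> 'm set"
  action :: "'e \<Rightarrow> 'm \<Rightarrow> 'm"

definition linear_between ::
    "('i \<Rightarrow> 'k::field) set \<Rightarrow> ('j \<Rightarrow> 'k) set \<Rightarrow> (('i \<Rightarrow> 'k) \<Rightarrow> ('j \<Rightarrow> 'k)) \<Rightarrow> bool" where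
  "linear_between U V f \<longleftrightarrow> f ` U \<subseteq> V \<and>
     (\<forall>x\<in>U. \<forall>y\<in>U. f (x + y) = f x + f y) \<and>
     (\<forall>c. \<forall>x\<in>U. f (scale_fun c x) = scale_fun c (f x))"

definition rep_carrier ::
    "('v, 'e) pre_digraph \<Rightarrow> ('v, 'e, 'i \<Rightarrow> 'k::field) quiver_rep \<Rightarrow> ('i \<Rightarrow> 'k) set" where
  "rep_carrier Q M = fun_vs.span (\<Union>v\<in>verts Q. vspace M v)"

definition bound_rep :: "('v, 'e) pre_digraph \<Rightarrow> ('v, 'e) path set \<Rightarrow>
    ('v, 'e, 'i \<Rightarrow> 'k::field) quiver_rep \<Rightarrow> bool" where
  "bound_rep Q \<rho> M \<longleftrightarrow>
     (\<forall>v\<in>verts Q. fun_vs.subspace (vspace M v)) \<and>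
     (\<forall>S x. finite S \<and> S \<subseteq> verts Q \<and> (\<forall>v\<in>S. x v \<in> vspace M v) \<and> (\<Sum>v\<in>S. x v) = 0
        \<longrightarrow> (\<forall>v\<in>S. x v = 0)) \<and>
     (\<exists>B. finite B \<and> rep_carrier Q M = fun_vs.span B) \<and>
     (\<forall>e\<in>arcs Q. linear_between (vspace M (tail Q e)) (vspace M (head Q e)) (action M e)) \<and>
     (\<forall>(u, es)\<in>\<rho>. \<forall>x\<in>vspace M u. fold (action M) es x = 0)"

text \<open>Homomorphisms are given on the direct sums. Compatibility with the spaces at the
  vertices is linearity with respect to the trivial paths.\<close>

definition rep_hom :: "('v, 'e) pre_digraph \<Rightarrow> ('v, 'e, 'i \<Rightarrow> 'k::field) quiver_rep \<Rightarrow>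
    ('v, 'e, 'j \<Rightarrow> 'k) quiver_rep \<Rightarrow> (('i \<Rightarrow> 'k) \<Rightarrow> ('j \<Rightarrow> 'k)) \<Rightarrow> bool" where
  "rep_hom Q M N H \<longleftrightarrow>
     linear_between (rep_carrier Q M) (rep_carrier Q N) H \<and>
     (\<forall>v\<in>verts Q. H ` vspace M v \<subseteq> vspace N v) \<and>
     (\<forall>e\<in>arcs Q. \<forall>x\<in>vspace M (tail Q e). H (action M e x) = action N e (H x))"

section \<open>Trees and generalised tree modules\<close>

definition double_quiver :: "('v, 'e) pre_digraph \<Rightarrow> ('v, 'e \<times> bool) pre_digraph" where
  "double_quiver T = \<lparr>verts = verts T, arcs = arcs T \<times> UNIV,
     tail = (\<lambda>(e, d). if d then tail T e else head T e),
     head = (\<lambda>(e, d). if d then head T e else tail T e)\<rparr>"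

text \<open>The predicate \<open>tree\<close> of \<open>Graph_Theory\<close> only excludes directed cycles. A cycle of the
  underlying undirected multigraph is a cycle of the double quiver that does not use an
  arrow twice; loops and pairs of parallel or opposite arrows give such cycles.\<close>

definition tree_quiver :: "(nat, 'a) pre_digraph \<Rightarrow> bool" where
  "tree_quiver T \<longleftrightarrow> fin_digraph T \<and> connected T \<and>
     \<not> (\<exists>p. pre_digraph.cycle (double_quiver T) p \<and> distinct (map fst p))"

record ('a, 'v, 'e) quiver_map =
  vmap :: "nat \<Rightarrow> 'v"
  amap :: "'a \<Rightarrow> 'e"

definition quiver_morphism ::
    "(nat, 'a) pre_digraph \<Rightarrow> ('v, 'e) pre_digraph \<Rightarrow> ('a, 'v, 'e) quiver_map \<Rightarrow> bool" where
  "quiver_morphism T Q F \<longleftrightarrow>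
     (\<forall>n\<in>verts T. vmap F n \<in> verts Q) \<and>
     (\<forall>a\<in>arcs T. amap F a \<in> arcs Q \<and>
        tail Q (amap F a) = vmap F (tail T a) \<and> head Q (amap F a) = vmap F (head T a))"

definition bound_quiver_morphism :: "'k::field itself \<Rightarrow> (nat, 'a) pre_digraph \<Rightarrow>
    ('v, 'e) pre_digraph \<Rightarrow> ('v, 'e) path set \<Rightarrow> ('a, 'v, 'e) quiver_map \<Rightarrow> bool" where
  "bound_quiver_morphism K T Q \<rho> F \<longleftrightarrow> quiver_morphism T Q F \<and>
     (\<forall>(n, as)\<in>paths T.
        (unit_vec (vmap F n, map (amap F) as) :: ('v, 'e) path \<Rightarrow> 'k) \<notin> generated_ideal Q \<rho>)"

text \<open>The basis vector of a tree module belonging to the vertex \<open>n\<close> is \<open>unit_vec n\<close>.\<close>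

definition tree_module :: "(nat, 'a) pre_digraph \<Rightarrow> ('a, 'v, 'e) quiver_map \<Rightarrow>
    ('v, 'e, nat \<Rightarrow> 'k::field) quiver_rep" where
  "tree_module T F = \<lparr>
     vspace = (\<lambda>v. fun_vs.span (unit_vec ` {n \<in> verts T. vmap F n = v})),
     action = (\<lambda>e x. \<Sum>n\<in>verts T. scale_fun (x n)
       (\<Sum>a\<in>{a \<in> arcs T. tail T a = n \<and> amap F a = e}. unit_vec (head T a)))\<rparr>"

lemma sum_fun_apply: "sum f A i = (\<Sum>a\<in>A. f a i)"
  by (induction A rule: infinite_finite_induct) auto

lemma span_unit_vec_apply:
  assumes "x \<in> fun_vs.span (unit_vec ` A)" and "i \<notin> A"
  shows "x i = 0"
proof -
  have "fun_vs.span (unit_vec ` A) \<subseteq> {x. x i = 0}"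
    by (rule fun_vs.span_minimal) (use assms(2) in \<open>auto simp: fun_vs.subspace_def unit_vec_def\<close>)
  then show ?thesis using assms(1) by blast
qed

lemma rep_carrier_tree_module:
  assumes "quiver_morphism T Q F"
  shows "rep_carrier Q (tree_module T F) = fun_vs.span (unit_vec ` verts T)"
proof (rule antisym)
  show "rep_carrier Q (tree_module T F) \<subseteq> fun_vs.span (unit_vec ` verts T)"
    unfolding rep_carrier_def tree_module_def quiver_rep.simps
    by (intro fun_vs.span_minimal UN_least fun_vs.span_mono fun_vs.subspace_span) blast
  show "fun_vs.span (unit_vec ` verts T) \<subseteq> rep_carrier Q (tree_module T F)"
    unfolding rep_carrier_def
  proof (rule fun_vs.span_mono, safe)
    fix n assume "n \<in> verts T"
    then have "vmap F n \<in> verts Q" "unit_vec n \<in> vspace (tree_module T F) (vmap F n)"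
      using assms by (auto simp: quiver_morphism_def tree_module_def intro!: fun_vs.span_base)
    then show "unit_vec n \<in> (\<Union>v\<in>verts Q. vspace (tree_module T F) v)" by blast
  qed
qed

lemma action_tree_module_nonzero:
  fixes x :: "nat \<Rightarrow> 'k::field"
  assumes "action (tree_module T F) e x k \<noteq> 0"
  shows "\<exists>a\<in>arcs T. head T a = k \<and> amap F a = e \<and> x (tail T a) \<noteq> 0"
proof -
  let ?A = "\<lambda>n. {a \<in> arcs T. tail T a = n \<and> amap F a = e}"
  have "(\<Sum>n\<in>verts T. x n * (\<Sum>a\<in>?A n. unit_vec (head T a) k)) \<noteq> 0"
    using assms by (simp add: tree_module_def sum_fun_apply)
  then obtain n where n: "x n * (\<Sum>a\<in>?A n. unit_vec (head T a) k) \<noteq> 0"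
    by (rule sum.not_neutral_contains_not_neutral)
  then have "(\<Sum>a\<in>?A n. unit_vec (head T a) k :: 'k) \<noteq> 0" by simp
  then obtain a where "a \<in> ?A n" "unit_vec (head T a) k \<noteq> (0::'k)"
    by (rule sum.not_neutral_contains_not_neutral)
  with n show ?thesis by (auto simp: unit_vec_def split: if_splits)
qed

lemma fold_action_tree_module_nonzero:
  assumes "wf_digraph T" and "\<And>n. x n \<noteq> 0 \<Longrightarrow> n \<in> verts T"
    and "fold (action (tree_module T F)) es x k \<noteq> 0"
  shows "\<exists>n p. x n \<noteq> 0 \<and> pre_digraph.awalk T n p k \<and> map (amap F) p = es"
  using assms(2,3)
proof (induction es arbitrary: x)
  case Nil
  then have "x k \<noteq> 0 \<and> pre_digraph.awalk T k [] k \<and> map (amap F) [] = []"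
    by (simp add: pre_digraph.awalk_def pre_digraph.cas.simps)
  then show ?case by (intro exI)
next
  case (Cons e es)
  let ?y = "action (tree_module T F) e x"
  have "n \<in> verts T" if "?y n \<noteq> 0" for n
    using action_tree_module_nonzero[OF that] wf_digraph.head_in_verts[OF assms(1)] by blast
  moreover have "fold (action (tree_module T F)) es ?y k \<noteq> 0"
    using Cons.prems(2) unfolding fold_simps .
  ultimately have "\<exists>n p. ?y n \<noteq> 0 \<and> pre_digraph.awalk T n p k \<and> map (amap F) p = es"
    by (rule Cons.IH)
  then obtain n p where np: "?y n \<noteq> 0" "pre_digraph.awalk T n p k" "map (amap F) p = es"
    by (elim exE conjE)
  obtain a where a: "a \<in> arcs T" "head T a = n" "amap F a = e" "x (tail T a) \<noteq> 0"
    using action_tree_module_nonzero[OF np(1)] by (elim bexE conjE)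
  have "pre_digraph.awalk T (tail T a) (a # p) k"
    using np(2) a(1,2) Cons.prems(1)[OF a(4)] by (simp add: pre_digraph.awalk_def pre_digraph.cas.simps)
  with a(3,4) np(3) show ?case
    by (intro exI[of _ "tail T a"] exI[of _ "a # p"]) simp
qed

text \<open>A generalised tree module is indeed a module over the zero-relation algebra.\<close>

lemma bound_rep_tree_module:
  assumes "tree_quiver T" and F: "bound_quiver_morphism TYPE('k) T Q \<rho> F"
  shows "bound_rep Q \<rho> (tree_module T F :: ('v, 'e, nat \<Rightarrow> 'k::field) quiver_rep)"
proof -
  let ?M = "tree_module T F :: ('v, 'e, nat \<Rightarrow> 'k) quiver_rep"
  interpret fin_digraph T using assms(1) by (simp add: tree_quiver_def)
  have mor: "quiver_morphism T Q F" using F by (simp add: bound_quiver_morphism_def)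
  have supp: "n \<in> verts T \<and> vmap F n = v" if "x \<in> vspace ?M v" "x n \<noteq> 0" for x v n
    using span_unit_vec_apply[of x "{n \<in> verts T. vmap F n = v}" n] that
    by (auto simp: tree_module_def)
  have indep: "x v = 0"
    if S: "finite S" "\<forall>v\<in>S. x v \<in> vspace ?M v" "(\<Sum>v\<in>S. x v) = 0" "v \<in> S" for S x v
  proof (rule ext)
    fix n
    show "x v n = 0 n"
    proof (cases "vmap F n = v")
      case True
      have "x w n = 0" if "w \<in> S - {v}" for w
        using supp[of "x w" w n] S(2) that True by auto
      then have "(\<Sum>w\<in>S - {v}. x w n) = 0" by (simp add: sum.neutral)
      moreover have "(\<Sum>w\<in>S. x w n) = 0"
        using fun_cong[OF S(3), of n] by (simp add: sum_fun_apply)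
      ultimately show ?thesis
        using sum.remove[OF S(1,4), of "\<lambda>w. x w n"] by simp
    next
      case False
      then show ?thesis using supp[of "x v" v n] S(2,4) by auto
    qed
  qed
  have fin_dim: "\<exists>B. finite B \<and> rep_carrier Q ?M = fun_vs.span B"
    by (intro exI[of _ "unit_vec ` verts T"] conjI rep_carrier_tree_module[OF mor]
        finite_imageI finite_verts)
  have arrows: "linear_between (vspace ?M (tail Q e)) (vspace ?M (head Q e)) (action ?M e)"
    if "e \<in> arcs Q" for e
  proof -
    have "unit_vec (head T a) \<in> fun_vs.span (unit_vec ` {n \<in> verts T. vmap F n = head Q e})"
      if "a \<in> arcs T" "amap F a = e" for a
      using mor that by (intro fun_vs.span_base imageI) (auto simp: quiver_morphism_def)
    then have "action ?M e x \<in> vspace ?M (head Q e)" for x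
      unfolding tree_module_def quiver_rep.simps
      by (intro fun_vs.span_sum fun_vs.span_scale) (elim CollectE conjE)
    moreover have "action ?M e (x + y) = action ?M e x + action ?M e y" for x y
      by (simp add: tree_module_def fun_vs.scale_left_distrib sum.distrib)
    moreover have "action ?M e (scale_fun c x) = scale_fun c (action ?M e x)" for c x
      by (simp add: tree_module_def fun_vs.scale_sum_right)
    ultimately show ?thesis by (simp add: linear_between_def image_subset_iff)
  qed
  have relations: "fold (action ?M) es x = 0" if "(u, es) \<in> \<rho>" "x \<in> vspace ?M u" for u es x
  proof (rule ccontr)
    assume "fold (action ?M) es x \<noteq> 0"
    then obtain k where k: "fold (action ?M) es x k \<noteq> 0" by (auto simp: fun_eq_iff)
    have "\<exists>n p. x n \<noteq> 0 \<and> awalk n p k \<and> map (amap F) p = es"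
    proof (rule fold_action_tree_module_nonzero[OF wf_digraph _ k])
      show "n \<in> verts T" if "x n \<noteq> 0" for n
        using supp[OF \<open>x \<in> vspace ?M u\<close> that] by (rule conjunct1)
    qed
    then obtain n p where np: "x n \<noteq> 0" "awalk n p k" "map (amap F) p = es"
      by (elim exE conjE)
    then have "(n, p) \<in> paths T" by (auto simp: paths_def)
    moreover have "vmap F n = u" using supp[OF that(2) np(1)] by (rule conjunct2)
    moreover have "unit_vec (u, es) \<in> (generated_ideal Q \<rho> :: (('v, 'e) path \<Rightarrow> 'k) set)"
      using that(1) by (auto simp: generated_ideal_def)
    ultimately show False using F np(3) by (auto simp: bound_quiver_morphism_def)
  qed
  have "fun_vs.subspace (vspace ?M v)" for v
    by (simp add: tree_module_def)
  moreover have "\<forall>(u, es)\<in>\<rho>. \<forall>x\<in>vspace ?M u. fold (action ?M) es x = 0"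
    by (intro ballI case_prodI2 relations) simp_all
  moreover have "\<forall>S x. finite S \<and> S \<subseteq> verts Q \<and> (\<forall>v\<in>S. x v \<in> vspace ?M v) \<and> (\<Sum>v\<in>S. x v) = 0
      \<longrightarrow> (\<forall>v\<in>S. x v = 0)"
    by (intro allI impI ballI, elim conjE, rule indep) assumption+
  ultimately show ?thesis
    unfolding bound_rep_def using fin_dim arrows by (intro conjI) (assumption | intro ballI)+
qed

section \<open>Networks\<close>

record ('x, 'y) network = "('x, 'y) pre_digraph" +
  edges :: "'x set set"

definition network :: "('x, 'y) network \<Rightarrow> bool" where
  "network N \<longleftrightarrow> (\<forall>e\<in>arcs N. tail N e \<in> verts N \<and> head N e \<in> verts N) \<and>
     (\<forall>E\<in>edges N. E \<subseteq> verts N \<and> card E = 2)"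

definition subnetwork :: "('x, 'y) network \<Rightarrow> ('x, 'y) network \<Rightarrow> bool" where
  "subnetwork M N \<longleftrightarrow> network M \<and> verts M \<subseteq> verts N \<and> arcs M \<subseteq> arcs N \<and> edges M \<subseteq> edges N \<and>
     tail M = tail N \<and> head M = head N"

definition link :: "('x, 'y) network \<Rightarrow> 'x \<Rightarrow> 'x \<Rightarrow> bool" where
  "link N x y \<longleftrightarrow>
     (\<exists>e\<in>arcs N. (tail N e = x \<and> head N e = y) \<or> (tail N e = y \<and> head N e = x)) \<or>
     {x, y} \<in> edges N"

definition network_connected :: "('x, 'y) network \<Rightarrow> bool" where
  "network_connected N \<longleftrightarrow> (\<forall>x\<in>verts N. \<forall>y\<in>verts N. (link N)\<^sup>*\<^sup>* x y)"

definition pullback_verts ::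
    "(nat, 'a) pre_digraph \<Rightarrow> ('a, 'v, 'e) quiver_map \<Rightarrow>
     (nat, 'b) pre_digraph \<Rightarrow> ('b, 'v, 'e) quiver_map \<Rightarrow> (nat \<times> nat) set" where
  "pullback_verts T1 F1 T2 F2 =
     {(n, m). n \<in> verts T1 \<and> m \<in> verts T2 \<and> vmap F1 n = vmap F2 m}"

definition pullback_network ::
    "(nat, 'a) pre_digraph \<Rightarrow> ('a, 'v, 'e) quiver_map \<Rightarrow>
     (nat, 'b) pre_digraph \<Rightarrow> ('b, 'v, 'e) quiver_map \<Rightarrow> (nat \<times> nat, 'a \<times> 'b) network" where
  "pullback_network T1 F1 T2 F2 = \<lparr>
     verts = pullback_verts T1 F1 T2 F2,
     arcs = {(a, b). a \<in> arcs T1 \<and> b \<in> arcs T2 \<and> amap F1 a = amap F2 b},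
     tail = (\<lambda>(a, b). (tail T1 a, tail T2 b)),
     head = (\<lambda>(a, b). (head T1 a, head T2 b)),
     edges =
       {{(n, m), (n', m)} | n n' m.
          (n, m) \<in> pullback_verts T1 F1 T2 F2 \<and> (n', m) \<in> pullback_verts T1 F1 T2 F2 \<and>
          n \<noteq> n' \<and> (\<exists>a\<in>arcs T1. \<exists>b\<in>arcs T1. tail T1 a = tail T1 b \<and>
             head T1 a = n \<and> head T1 b = n' \<and> amap F1 a = amap F1 b)} \<union>
       {{(n, m), (n, m')} | n m m'.
          (n, m) \<in> pullback_verts T1 F1 T2 F2 \<and> (n, m') \<in> pullback_verts T1 F1 T2 F2 \<and>
          m \<noteq> m' \<and> (\<exists>c\<in>arcs T2. \<exists>d\<in>arcs T2. head T2 c = head T2 d \<and>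
             tail T2 c = m \<and> tail T2 d = m' \<and> amap F2 c = amap F2 d)}\<rparr>"

definition covering_network ::
    "(nat, 'a) pre_digraph \<Rightarrow> ('a, 'v, 'e) quiver_map \<Rightarrow>
     (nat, 'b) pre_digraph \<Rightarrow> ('b, 'v, 'e) quiver_map \<Rightarrow>
     (nat \<times> nat \<times> int, 'a \<times> 'b \<times> int) network" where
  "covering_network T1 F1 T2 F2 = (let N = pullback_network T1 F1 T2 F2 in \<lparr>
     verts = {(n, m, j). (n, m) \<in> verts N \<and> j \<in> {-1, 1}},
     arcs = {(a, b, j). (a, b) \<in> arcs N \<and> j \<in> {-1, 1}},
     tail = (\<lambda>(a, b, j). (tail T1 a, tail T2 b, j)),
     head = (\<lambda>(a, b, j). (head T1 a, head T2 b, j)),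
     edges = {{(n, m, j), (n', m', -j)} | n m n' m' j.
        {(n, m), (n', m')} \<in> edges N \<and> j \<in> {-1, 1}}\<rparr>)"

lemma network_pullback:
  assumes "wf_digraph T1" "wf_digraph T2" "quiver_morphism T1 Q F1" "quiver_morphism T2 Q F2"
  shows "network (pullback_network T1 F1 T2 F2)"
proof -
  have "vmap F1 (tail T1 a) = vmap F2 (tail T2 b) \<and> vmap F1 (head T1 a) = vmap F2 (head T2 b)"
    if "a \<in> arcs T1" "b \<in> arcs T2" "amap F1 a = amap F2 b" for a b
    using assms(3,4) that unfolding quiver_morphism_def by metis
  then show ?thesis
    using assms(1,2)
    by (auto simp: network_def pullback_network_def pullback_verts_def
        wf_digraph.tail_in_verts wf_digraph.head_in_verts)
qed

lemma network_covering:
  assumes "wf_digraph T1" "wf_digraph T2" "quiver_morphism T1 Q F1" "quiver_morphism T2 Q F2"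
  shows "network (covering_network T1 F1 T2 F2)"
proof -
  let ?N = "pullback_network T1 F1 T2 F2"
  have N: "network ?N" using assms by (rule network_pullback)
  have "x \<in> verts ?N \<and> y \<in> verts ?N" if "{x, y} \<in> edges ?N" for x y
    using N that by (auto simp: network_def)
  moreover have "tail ?N = (\<lambda>(a, b). (tail T1 a, tail T2 b))"
    "head ?N = (\<lambda>(a, b). (head T1 a, head T2 b))"
    by (simp_all add: pullback_network_def)
  moreover have "\<forall>(a, b)\<in>arcs ?N. (tail T1 a, tail T2 b) \<in> verts ?N \<and> (head T1 a, head T2 b) \<in> verts ?N"
    using N calculation(2,3) by (force simp: network_def)
  ultimately show ?thesis
    unfolding network_def covering_network_def Let_def
    by (auto simp: card_insert_if split: prod.splits)
qed

definition sheet_proj :: "nat \<times> nat \<times> int \<Rightarrow> nat \<times> nat" where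
  "sheet_proj = (\<lambda>(n, m, j). (n, m))"

definition complete ::
    "(nat, 'a) pre_digraph \<Rightarrow> ('a, 'v, 'e) quiver_map \<Rightarrow>
     (nat, 'b) pre_digraph \<Rightarrow> ('b, 'v, 'e) quiver_map \<Rightarrow>
     (nat \<times> nat \<times> int, 'a \<times> 'b \<times> int) network \<Rightarrow> bool" where
  "complete T1 F1 T2 F2 M \<longleftrightarrow> (\<forall>(n, m, j)\<in>verts M.
     (\<forall>a\<in>arcs T1. head T1 a = n \<longrightarrow>
        (\<exists>b\<in>arcs T2. head T2 b = m \<and> (a, b, j) \<in> arcs M) \<or>
        (\<exists>c\<in>arcs T1. tail T1 c = tail T1 a \<and> amap F1 a = amap F1 c \<and>
           (head T1 c, m, -j) \<in> verts M \<and> {(n, m, j), (head T1 c, m, -j)} \<in> edges M)) \<and>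
     (\<forall>b\<in>arcs T2. tail T2 b = m \<longrightarrow>
        (\<exists>a\<in>arcs T1. tail T1 a = n \<and> (a, b, j) \<in> arcs M) \<or>
        (\<exists>d\<in>arcs T2. head T2 d = head T2 b \<and> amap F2 b = amap F2 d \<and>
           (n, tail T2 d, -j) \<in> verts M \<and> {(n, m, j), (n, tail T2 d, -j)} \<in> edges M)))"

definition R2_free ::
    "(nat, 'a) pre_digraph \<Rightarrow> ('a, 'v, 'e) quiver_map \<Rightarrow>
     (nat, 'b) pre_digraph \<Rightarrow> ('b, 'v, 'e) quiver_map \<Rightarrow>
     (nat \<times> nat \<times> int, 'a \<times> 'b \<times> int) network \<Rightarrow> bool" where
  "R2_free T1 F1 T2 F2 M \<longleftrightarrow> (let N = pullback_network T1 F1 T2 F2 in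
     \<not> (\<exists>x\<in>verts M. \<exists>y\<in>verts M. \<exists>z\<in>verts M. link M x y \<and> link M y z \<and>
          distinct [sheet_proj x, sheet_proj y, sheet_proj z] \<and>
          link N (sheet_proj x) (sheet_proj y) \<and> link N (sheet_proj y) (sheet_proj z) \<and>
          link N (sheet_proj x) (sheet_proj z)))"

definition involution_free :: "(nat \<times> nat \<times> int, 'y) network \<Rightarrow> bool" where
  "involution_free M \<longleftrightarrow> (\<forall>(n, m, j)\<in>verts M. (n, m, -j) \<notin> verts M)"

definition involution_invariant ::
    "(nat, 'a) pre_digraph \<Rightarrow> ('a, 'v, 'e) quiver_map \<Rightarrow>
     (nat, 'b) pre_digraph \<Rightarrow> ('b, 'v, 'e) quiver_map \<Rightarrow>
     (nat \<times> nat \<times> int, 'a \<times> 'b \<times> int) network \<Rightarrow> bool" where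
  "involution_invariant T1 F1 T2 F2 M \<longleftrightarrow>
     verts M = {x \<in> verts (covering_network T1 F1 T2 F2). sheet_proj x \<in> sheet_proj ` verts M}"

definition generalised_graph_map ::
    "(nat, 'a) pre_digraph \<Rightarrow> ('a, 'v, 'e) quiver_map \<Rightarrow>
     (nat, 'b) pre_digraph \<Rightarrow> ('b, 'v, 'e) quiver_map \<Rightarrow>
     (nat \<times> nat \<times> int, 'a \<times> 'b \<times> int) network \<Rightarrow> bool" where
  "generalised_graph_map T1 F1 T2 F2 G \<longleftrightarrow>
     subnetwork G (covering_network T1 F1 T2 F2) \<and> verts G \<noteq> {} \<and> network_connected G \<and>
     involution_free G \<and> complete T1 F1 T2 F2 G \<and> R2_free T1 F1 T2 F2 G"

definition ghost ::
    "(nat, 'a) pre_digraph \<Rightarrow> ('a, 'v, 'e) quiver_map \<Rightarrow>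
     (nat, 'b) pre_digraph \<Rightarrow> ('b, 'v, 'e) quiver_map \<Rightarrow>
     (nat \<times> nat \<times> int, 'a \<times> 'b \<times> int) network \<Rightarrow> bool" where
  "ghost T1 F1 T2 F2 G \<longleftrightarrow>
     subnetwork G (covering_network T1 F1 T2 F2) \<and> verts G \<noteq> {} \<and> network_connected G \<and>
     involution_invariant T1 F1 T2 F2 G \<and> complete T1 F1 T2 F2 G \<and> R2_free T1 F1 T2 F2 G"

definition ghost_free ::
    "(nat, 'a) pre_digraph \<Rightarrow> ('a, 'v, 'e) quiver_map \<Rightarrow>
     (nat, 'b) pre_digraph \<Rightarrow> ('b, 'v, 'e) quiver_map \<Rightarrow> bool" where
  "ghost_free T1 F1 T2 F2 \<longleftrightarrow> \<not> (\<exists>G. ghost T1 F1 T2 F2 G)"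

definition graph_map_hom :: "(nat, 'a) pre_digraph \<Rightarrow> (nat \<times> nat \<times> int, 'y) network \<Rightarrow>
    (nat \<Rightarrow> 'k::field) \<Rightarrow> (nat \<Rightarrow> 'k)" where
  "graph_map_hom T1 G x = (\<Sum>n\<in>verts T1. scale_fun (x n)
     (\<Sum>(n', m, j)\<in>{g \<in> verts G. fst g = n}. scale_fun (of_int j) (unit_vec m)))"

end

theory Submission
  imports Defs
begin

text \<open>The matrix of a homomorphism satisfies one linear equation for every triple
  \<open>(n, m, e)\<close>, and the entries occurring in that equation form a clique of the pullback network.
  Hence no clique meets the support of the matrix in exactly one point. Let \<open>S\<close> be a minimal
  non-empty subset of the support with this property and choose a fixed-point-free permutation
  \<open>\<sigma>\<close> of the trace of \<open>S\<close> on every clique. In the covering network join every vertex lying on the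
  appropriate sheet over \<open>x\<close> to the vertex of opposite signed value over \<open>\<sigma> x\<close>. Every connected
  component of the result projects onto \<open>S\<close> by minimality. So if a component contains both lifts
  of some vertex, then it meets every other component and is a ghost; otherwise it is a generalised
  graph map supported in the support of the matrix. Subtracting a multiple of it kills an entry
  without enlarging the support.\<close>

section \<open>Short cycles in trees\<close>

definition adjacent :: "(nat, 'a) pre_digraph \<Rightarrow> nat \<Rightarrow> nat \<Rightarrow> bool" where
  "adjacent T u v \<longleftrightarrow> (\<exists>a\<in>arcs T. {tail T a, head T a} = {u, v})"

lemma adjacent_sym: "adjacent T u v \<Longrightarrow> adjacent T v u"
  by (simp add: adjacent_def insert_commute)

lemma adjacent_arc: "a \<in> arcs T \<Longrightarrow> adjacent T (tail T a) (head T a)"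
  by (auto simp: adjacent_def)

lemma adjacentE:
  assumes "adjacent T u v"
  obtains e where "e \<in> arcs (double_quiver T)"
    "tail (double_quiver T) e = u" "head (double_quiver T) e = v"
    "{tail T (fst e), head T (fst e)} = {u, v}"
proof -
  obtain a where a: "a \<in> arcs T" "{tail T a, head T a} = {u, v}"
    using assms by (auto simp: adjacent_def)
  then consider "tail T a = u \<and> head T a = v" | "head T a = u \<and> tail T a = v"
    by (auto simp: doubleton_eq_iff)
  then show ?thesis
  proof cases
    case 1 then show ?thesis using a that[of "(a, True)"] by (auto simp: double_quiver_def)
  next
    case 2 then show ?thesis using a that[of "(a, False)"] by (auto simp: double_quiver_def)
  qed
qed

text \<open>The last conjunct is the invariant that yields \<open>distinct (map fst p)\<close>: the
  arrow put in front has the endpoint \<open>u\<close>, which lies on no arrow of the rest. With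
  \<open>cas\<close> instead of \<open>awalk\<close>, membership of the vertices need not be carried
  along.\<close>

lemma double_quiver_path:
  assumes "successively (adjacent T) (u # vs)" "distinct (u # vs)"
  shows "\<exists>p. set p \<subseteq> arcs (double_quiver T) \<and> pre_digraph.cas (double_quiver T) u p (last (u # vs)) \<and>
    pre_digraph.awalk_verts (double_quiver T) u p = u # vs \<and> distinct (map fst p) \<and>
    (\<forall>a\<in>fst ` set p. {tail T a, head T a} \<subseteq> set (u # vs))"
  using assms
proof (induction vs arbitrary: u)
  case Nil
  show ?case by (rule exI[of _ "[]"]) (simp add: pre_digraph.cas.simps pre_digraph.awalk_verts.simps)
next
  case (Cons v vs)
  obtain p where p: "set p \<subseteq> arcs (double_quiver T)"
    "pre_digraph.cas (double_quiver T) v p (last (v # vs))"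
    "pre_digraph.awalk_verts (double_quiver T) v p = v # vs" "distinct (map fst p)"
    "\<forall>a\<in>fst ` set p. {tail T a, head T a} \<subseteq> set (v # vs)"
    using Cons.IH[of v] Cons.prems by auto
  have "adjacent T u v" using Cons.prems by simp
  then obtain e where e: "e \<in> arcs (double_quiver T)"
    "tail (double_quiver T) e = u" "head (double_quiver T) e = v"
    "{tail T (fst e), head T (fst e)} = {u, v}" by (rule adjacentE)
  have "fst e \<notin> fst ` set p"
  proof
    assume "fst e \<in> fst ` set p"
    then have "{u, v} \<subseteq> set (v # vs)" using p(5) e(4) by metis
    then show False using Cons.prems(2) by auto
  qed
  moreover have "\<forall>a\<in>fst ` set (e # p). {tail T a, head T a} \<subseteq> set (u # v # vs)"
    using p(5) e(4) by auto
  ultimately show ?case using p e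
    by (intro exI[of _ "e # p"]) (auto simp: pre_digraph.cas.simps pre_digraph.awalk_verts.simps)
qed

text \<open>Joining \<open>u\<close> to both ends of the path through \<open>vs\<close> closes a
  cycle of the double quiver. Its underlying arrows are distinct: those at \<open>u\<close> do not
  occur on the path, and the two of them differ because their other endpoints do, which is where
  \<open>length vs \<ge> 2\<close> enters.\<close>

lemma tree_quiver_no_cycle:
  assumes T: "tree_quiver T" and adj: "successively (adjacent T) (u # vs)" "adjacent T (last vs) u"
    and "distinct (u # vs)" "length vs \<ge> 2"
  shows False
proof -
  let ?D = "double_quiver T"
  interpret D: pre_digraph ?D .
  obtain v w ws where vs: "vs = v # w # ws"
    using assms(5) by (metis Suc_le_length_iff numeral_2_eq_2)
  have wf: "wf_digraph T" using T by (auto simp: tree_quiver_def fin_digraph_def)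
  obtain p where p: "set p \<subseteq> arcs ?D" "D.cas v p (last vs)"
    "D.awalk_verts v p = vs" "distinct (map fst p)"
    "\<forall>a\<in>fst ` set p. {tail T a, head T a} \<subseteq> set vs"
    using double_quiver_path[of T v "w # ws"] assms(2,4) vs by auto
  have "adjacent T u v" using adj(1) vs by simp
  then obtain e where e: "e \<in> arcs ?D" "tail ?D e = u" "head ?D e = v"
    "{tail T (fst e), head T (fst e)} = {u, v}" by (rule adjacentE)
  obtain f where f: "f \<in> arcs ?D" "tail ?D f = last vs" "head ?D f = u"
    "{tail T (fst f), head T (fst f)} = {last vs, u}" using adj(2) by (rule adjacentE)
  have cas_append: "D.cas x (q @ [f]) u" if "D.cas x q (last vs)" for x q
    using that f by (induction q arbitrary: x) auto
  have verts_append: "D.awalk_verts x (q @ [f]) = D.awalk_verts x q @ [u]"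
    if "D.cas x q (last vs)" for x q
    using that f by (induction q arbitrary: x) auto
  have "u \<in> verts ?D"
    using e(1,2) wf by (auto simp: double_quiver_def wf_digraph_def split: if_splits)
  then have "D.awalk u (e # p @ [f]) u"
    using p(1) e f cas_append[OF p(2)] \<open>u \<in> verts ?D\<close> by (auto simp: D.awalk_def)
  moreover have "distinct (tl (D.awalk_verts u (e # p @ [f])))"
    using verts_append[OF p(2)] p(3) assms(4) e by auto
  moreover have "distinct (map fst (e # p @ [f]))"
  proof -
    have "a \<notin> fst ` set p" if "u \<in> {tail T a, head T a}" for a
      using p(5) assms(4) that by (metis distinct.simps(2) in_mono)
    then have "fst e \<notin> fst ` set p" "fst f \<notin> fst ` set p"
      using e(4) f(4) by blast+
    moreover have "fst e \<noteq> fst f"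
    proof
      assume "fst e = fst f"
      then have "{u, v} = {last vs, u}" using e(4) f(4) by simp
      then have "v = last (w # ws)" using vs by (auto simp: doubleton_eq_iff split: if_splits)
      then show False using assms(4) vs last_in_set[of "w # ws"] by auto
    qed
    ultimately show ?thesis using p(4) by auto
  qed
  ultimately have "D.cycle (e # p @ [f]) \<and> distinct (map fst (e # p @ [f]))"
    by (auto simp: D.cycle_def)
  then show False using T unfolding tree_quiver_def by blast
qed

text \<open>Cycles of length one and two fall outside \<open>tree_quiver_no_cycle\<close>, so loops
  and, below, parallel and opposite arrows are excluded by exhibiting the cycle.\<close>

lemma tree_quiver_no_loop:
  assumes T: "tree_quiver T" and a: "a \<in> arcs T"
  shows "tail T a \<noteq> head T a"
proof
  assume "tail T a = head T a"
  then have "pre_digraph.cycle (double_quiver T) [(a, True)]"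
    using T a by (auto simp: pre_digraph.cycle_def pre_digraph.awalk_def pre_digraph.cas.simps
        pre_digraph.awalk_verts.simps double_quiver_def tree_quiver_def fin_digraph_def wf_digraph_def)
  then show False using T unfolding tree_quiver_def by fastforce
qed

lemma tree_quiver_no_parallel:
  assumes T: "tree_quiver T" and a: "a \<in> arcs T" "b \<in> arcs T"
    and eq: "tail T a = tail T b" "head T a = head T b"
  shows "a = b"
proof (rule ccontr)
  assume "a \<noteq> b"
  then have "pre_digraph.cycle (double_quiver T) [(a, True), (b, False)]"
    using T a eq tree_quiver_no_loop[OF T a(1)]
    by (auto simp: pre_digraph.cycle_def pre_digraph.awalk_def pre_digraph.cas.simps
        pre_digraph.awalk_verts.simps double_quiver_def tree_quiver_def fin_digraph_def wf_digraph_def)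
  then show False using T \<open>a \<noteq> b\<close> unfolding tree_quiver_def by fastforce
qed

lemma adjacent_irrefl: "tree_quiver T \<Longrightarrow> adjacent T u v \<Longrightarrow> u \<noteq> v"
  using tree_quiver_no_loop by (fastforce simp: adjacent_def)

lemma tree_quiver_no_triangle:
  assumes T: "tree_quiver T" and adj: "adjacent T u v" "adjacent T v w" "adjacent T w u"
  shows False
  using tree_quiver_no_cycle[OF T, of u "[v, w]"] adj adj[THEN adjacent_irrefl[OF T]] by auto

lemma tree_quiver_no_square:
  assumes T: "tree_quiver T"
    and adj: "adjacent T p u" "adjacent T p v" "adjacent T q u" "adjacent T q v" and "u \<noteq> v"
  shows "p = q"
proof (rule ccontr)
  assume "p \<noteq> q"
  then show False
    using tree_quiver_no_cycle[OF T, of p "[u, q, v]"] adj adj[THEN adjacent_irrefl[OF T]] \<open>u \<noteq> v\<close>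
    by (auto simp: adjacent_sym)
qed

text \<open>If \<open>p \<noteq> q\<close>, then \<open>p = r\<close> or \<open>q = r\<close> would
  leave a square, and \<open>p = w\<close>, \<open>q = u\<close> or \<open>r = v\<close> a triangle;
  otherwise \<open>u, p, v, q, w, r\<close> is a 6-cycle. In the application \<open>u, v, w\<close>
  are the varying coordinates of three points that pairwise share a clique.\<close>

lemma tree_quiver_no_hexagon:
  assumes T: "tree_quiver T" and "distinct [u, v, w]"
    and p: "adjacent T p u" "adjacent T p v" and q: "adjacent T q v" "adjacent T q w"
    and r: "adjacent T r u" "adjacent T r w"
  shows "p = q"
proof (rule ccontr)
  note sq = tree_quiver_no_square[OF T] and tri = tree_quiver_no_triangle[OF T]
  assume "p \<noteq> q"
  then have "p \<noteq> r" "q \<noteq> r" using sq[OF p(2) _ q(1), of w] sq[OF p(1) _ _] assms by (metis distinct_length_2_or_more)+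
  moreover have "p \<noteq> w" "q \<noteq> u" "r \<noteq> v"
    using tri p q r adjacent_sym by metis+
  ultimately show False
    using tree_quiver_no_cycle[OF T, of u "[p, v, q, w, r]"] \<open>p \<noteq> q\<close> assms(2) p q r
      p[THEN adjacent_irrefl[OF T]] q[THEN adjacent_irrefl[OF T]] r[THEN adjacent_irrefl[OF T]]
    by (auto simp: adjacent_sym)
qed

lemma tree_quiver_no_antiparallel:
  assumes T: "tree_quiver T" and a: "a \<in> arcs T" "b \<in> arcs T"
    and eq: "tail T a = head T b" "head T a = tail T b"
  shows False
proof -
  have "a \<noteq> b" using tree_quiver_no_loop[OF T a(1)] eq by auto
  then have "pre_digraph.cycle (double_quiver T) [(a, True), (b, True)]"
    using T a eq tree_quiver_no_loop[OF T a(1)]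
    by (auto simp: pre_digraph.cycle_def pre_digraph.awalk_def pre_digraph.cas.simps
        pre_digraph.awalk_verts.simps double_quiver_def tree_quiver_def fin_digraph_def wf_digraph_def)
  then show False using T \<open>a \<noteq> b\<close> unfolding tree_quiver_def by fastforce
qed

section \<open>Cliques of the pullback network\<close>

definition lift :: "nat \<times> nat \<Rightarrow> int \<Rightarrow> nat \<times> nat \<times> int" where
  "lift x j = (fst x, snd x, j)"

definition sheet :: "nat \<times> nat \<times> int \<Rightarrow> int" where
  "sheet u = snd (snd u)"

lemma sheet_proj_lift [simp]: "sheet_proj (lift x j) = x"
  and sheet_lift [simp]: "sheet (lift x j) = j"
  and lift_sheet_proj [simp]: "lift (sheet_proj u) (sheet u) = u"
  by (auto simp: lift_def sheet_def sheet_proj_def split: prod.splits)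

locale tree_pair =
  fixes T1 :: "(nat, 'a) pre_digraph" and F1 :: "('a, 'v, 'e) quiver_map"
    and T2 :: "(nat, 'b) pre_digraph" and F2 :: "('b, 'v, 'e) quiver_map"
    and Q :: "('v, 'e) pre_digraph"
  assumes T1: "tree_quiver T1" and T2: "tree_quiver T2"
    and F1: "quiver_morphism T1 Q F1" and F2: "quiver_morphism T2 Q F2"
begin

abbreviation "PV \<equiv> pullback_verts T1 F1 T2 F2"
abbreviation "PN \<equiv> pullback_network T1 F1 T2 F2"
abbreviation "CN \<equiv> covering_network T1 F1 T2 F2"

text \<open>The clique \<open>(n, m, e)\<close> consists of the entries in the coefficient at \<open>w\<^sub>m\<close> of the equation
  \<open>H (e v\<^sub>n) = e (H v\<^sub>n)\<close>: \<open>outs\<close> comes from the left-hand side, \<open>ins\<close> from the right-hand side.\<close>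

definition outs :: "nat \<times> nat \<times> 'e \<Rightarrow> (nat \<times> nat) set" where
  "outs = (\<lambda>(n, m, e). (\<lambda>a. (head T1 a, m)) ` {a \<in> arcs T1. tail T1 a = n \<and> amap F1 a = e})"

definition ins :: "nat \<times> nat \<times> 'e \<Rightarrow> (nat \<times> nat) set" where
  "ins = (\<lambda>(n, m, e). (\<lambda>b. (n, tail T2 b)) ` {b \<in> arcs T2. head T2 b = m \<and> amap F2 b = e})"

text \<open>Membership in \<open>PV\<close> is not demanded: the functions to which the equations
  will be applied vanish outside \<open>PV\<close>.\<close>

definition clique :: "nat \<times> nat \<times> 'e \<Rightarrow> (nat \<times> nat) set" where
  "clique C = outs C \<union> ins C"

text \<open>The coefficient of the entry \<open>x\<close> in the equation of \<open>C\<close>. Only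
  values on \<open>clique C\<close> matter, so \<open>- 1\<close> stands for membership in
  \<open>ins C\<close>.\<close>

definition side :: "nat \<times> nat \<times> 'e \<Rightarrow> nat \<times> nat \<Rightarrow> int" where
  "side C x = (if x \<in> outs C then 1 else - 1)"

lemma side_cases: "side C x = 1 \<or> side C x = -1"
  by (simp add: side_def)

lemma outs_iff: "x \<in> outs (n, m, e) \<longleftrightarrow>
    (\<exists>a\<in>arcs T1. tail T1 a = n \<and> amap F1 a = e \<and> x = (head T1 a, m))"
  by (auto simp: outs_def)

lemma ins_iff: "x \<in> ins (n, m, e) \<longleftrightarrow>
    (\<exists>b\<in>arcs T2. head T2 b = m \<and> amap F2 b = e \<and> x = (n, tail T2 b))"
  by (auto simp: ins_def)

text \<open>A common point would force \<open>head T1 a = n = tail T1 a\<close>, a loop.\<close>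

lemma outs_ins_disjoint: "outs C \<inter> ins C = {}"
  using tree_quiver_no_loop[OF T1] by (cases C) (fastforce simp: outs_iff ins_iff)

lemma finite_arcs: "finite (arcs T1)" "finite (arcs T2)"
  using T1 T2 fin_digraph.finite_arcs by (auto simp: tree_quiver_def)

lemma finite_clique: "finite (outs C)" "finite (ins C)" "finite (clique C)"
  using finite_arcs by (auto simp: clique_def outs_def ins_def split: prod.splits)

lemma finite_PV: "finite PV"
proof -
  have "finite (verts T1 \<times> verts T2)"
    using T1 T2 by (auto simp: tree_quiver_def intro!: fin_digraph.finite_verts)
  then show ?thesis by (rule finite_subset[rotated]) (auto simp: pullback_verts_def)
qed

section \<open>Triangles of points that pairwise share a clique\<close>

lemma outs_outs:
  assumes "x \<in> outs (n, m, e)" "y \<in> outs (n, m, e)"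
  shows "snd x = m" "snd y = m" "adjacent T1 n (fst x)" "adjacent T1 n (fst y)"
  using assms adjacent_arc by (fastforce simp: outs_iff)+

lemma ins_ins:
  assumes "x \<in> ins (n, m, e)" "y \<in> ins (n, m, e)"
  shows "fst x = n" "fst y = n" "adjacent T2 m (snd x)" "adjacent T2 m (snd y)"
  using assms adjacent_arc adjacent_sym by (fastforce simp: ins_iff)+

lemma ins_outs:
  assumes "x \<in> ins (n, m, e)" "y \<in> outs (n, m, e)"
  shows "fst x = n" "snd y = m" "adjacent T1 (fst x) (fst y)" "adjacent T2 (snd x) (snd y)"
  using assms adjacent_arc by (fastforce simp: ins_iff outs_iff)+

text \<open>Two distinct points of a clique differ in the first coordinate only (both in
  \<open>outs\<close>), in the second only (both in \<open>ins\<close>), or in both, along an arrow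
  from the \<open>ins\<close> point to the \<open>outs\<close> point. Here \<open>x\<close> and
  \<open>y\<close> are of the first kind. Comparing coordinates leaves two configurations: three
  points of the first kind, settled by the hexagon lemma, and \<open>z\<close> as the common tail of
  arrows to \<open>x\<close> and \<open>y\<close>.\<close>

lemma triangle_outs:
  assumes xy: "x \<in> outs (n, m, e)" "y \<in> outs (n, m, e)"
    and yz: "y \<in> clique (n', m', e')" "z \<in> clique (n', m', e')"
    and xz: "x \<in> clique (n'', m'', e'')" "z \<in> clique (n'', m'', e'')"
    and d: "distinct [x, y, z]"
  shows "n' = n \<and> m' = m \<and> n'' = n \<and> m'' = m"
proof -
  note irr1 = adjacent_irrefl[OF T1] and irr2 = adjacent_irrefl[OF T2]
  note tri = tree_quiver_no_triangle[OF T1] and sq = tree_quiver_no_square[OF T1]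
  note E = outs_outs[OF xy]
  have xy_ne: "fst x \<noteq> fst y" using d E by (auto simp: prod_eq_iff)
  have arc_n: "\<exists>a\<in>arcs T1. tail T1 a = n \<and> head T1 a = fst x"
    "\<exists>a\<in>arcs T1. tail T1 a = n \<and> head T1 a = fst y"
    using xy by (auto simp: outs_iff)
  consider (oo) "y \<in> outs (n', m', e')" "z \<in> outs (n', m', e')"
    | (ii) "y \<in> ins (n', m', e')" "z \<in> ins (n', m', e')"
    | (io) "y \<in> ins (n', m', e')" "z \<in> outs (n', m', e')"
    | (oi) "y \<in> outs (n', m', e')" "z \<in> ins (n', m', e')"
    using yz by (auto simp: clique_def)
  note c1 = this
  consider (oo) "x \<in> outs (n'', m'', e'')" "z \<in> outs (n'', m'', e'')"
    | (ii) "x \<in> ins (n'', m'', e'')" "z \<in> ins (n'', m'', e'')"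
    | (io) "x \<in> ins (n'', m'', e'')" "z \<in> outs (n'', m'', e'')"
    | (oi) "x \<in> outs (n'', m'', e'')" "z \<in> ins (n'', m'', e'')"
    using xz by (auto simp: clique_def)
  note c2 = this
  \<comment> \<open>If arrows join \<open>z\<close> to both \<open>x\<close> and \<open>y\<close>,
    then \<open>fst z\<close> and \<open>n\<close> are common neighbours of the distinct vertices
    \<open>fst x\<close> and \<open>fst y\<close>, so they coincide.\<close>
  have arrow: "fst z = n \<and> snd z \<noteq> m" if "adjacent T1 (fst z) (fst x)" "adjacent T1 (fst z) (fst y)"
    "adjacent T2 (snd z) (snd x) \<or> adjacent T2 (snd z) (snd y)"
    using sq[OF that(1,2) E(3,4) xy_ne] that(3) E(1,2) irr2 by metis
  \<comment> \<open>Such an arrow would be opposite to one of the arrows of \<open>T1\<close> from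
    \<open>n\<close> to \<open>fst x\<close> and \<open>fst y\<close>.\<close>
  have no_arrow_into_n: "\<not> (u \<in> ins (n0, m0, e0) \<and> v \<in> outs (n0, m0, e0) \<and> fst v = n \<and>
      (fst u = fst x \<or> fst u = fst y))" for u v n0 m0 e0
    using arc_n tree_quiver_no_antiparallel[OF T1] by (auto simp: ins_iff outs_iff) metis+
  from c1 show ?thesis
  proof cases
    case oo
    note A = outs_outs[OF oo]
    from c2 show ?thesis
    proof cases
      case oo
      note B = outs_outs[OF oo]
      have dd: "distinct [fst x, fst y, fst z]" "distinct [fst y, fst x, fst z]"
        using d A B E by (auto simp: prod_eq_iff)
      have "n = n'" by (rule tree_quiver_no_hexagon[OF T1 dd(1) E(3,4) A(3,4) B(3,4)])
      moreover have "n = n''" by (rule tree_quiver_no_hexagon[OF T1 dd(2) E(4,3) B(3,4) A(3,4)])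
      ultimately show ?thesis using A B E by metis
    next
      case ii then show ?thesis using ins_ins[OF ii] A E d by (auto simp: prod_eq_iff)
    next
      case io then show ?thesis using ins_outs[OF io] A E irr2 by metis
    next
      case oi then show ?thesis using ins_outs[OF oi(2,1)] A E irr2 by metis
    qed
  next
    case ii
    note A = ins_ins[OF ii]
    from c2 show ?thesis
    proof cases
      case oo then show ?thesis using outs_outs[OF oo] A E d by (auto simp: prod_eq_iff)
    next
      case ii then show ?thesis using ins_ins[OF ii] A E xy_ne by metis
    next
      case io then show ?thesis using ins_outs[OF io] A E tri adjacent_sym by metis
    next
      case oi then show ?thesis using ins_outs[OF oi(2,1)] A E tri adjacent_sym by metis
    qed
  next
    case io
    note A = ins_outs[OF io]
    from c2 show ?thesis
    proof cases
      case oo then show ?thesis using outs_outs[OF oo] A E irr2 by metis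
    next
      case ii then show ?thesis using ins_ins[OF ii] A E tri adjacent_sym by metis
    next
      case c: io then show ?thesis
        using ins_outs[OF c] A arrow no_arrow_into_n io adjacent_sym by metis
    next
      case oi then show ?thesis
        using ins_outs[OF oi(2,1)] A arrow no_arrow_into_n io adjacent_sym by metis
    qed
  next
    case oi
    note A = ins_outs[OF oi(2,1)]
    from c2 show ?thesis
    proof cases
      case oo then show ?thesis using outs_outs[OF oo] A E irr2 by metis
    next
      case ii then show ?thesis using ins_ins[OF ii] A E tri adjacent_sym by metis
    next
      case io then show ?thesis
        using ins_outs[OF io] A arrow no_arrow_into_n adjacent_sym by metis
    next
      \<comment> \<open>Here \<open>z\<close> is the tail of both arrows, so \<open>n'\<close> and
        \<open>n''\<close> equal \<open>fst z\<close>, which is \<open>n\<close>.\<close>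
      case c: oi then show ?thesis
        using ins_outs[OF c(2,1)] A E arrow by metis
    qed
  qed
qed

text \<open>Mirror image of \<open>triangle_outs\<close> in \<open>T2\<close> with arrows reversed:
  besides three points of \<open>ins\<close>, the surviving configuration has \<open>z\<close> as
  the common head of arrows from \<open>x\<close> and \<open>y\<close>.\<close>

lemma triangle_ins:
  assumes xy: "x \<in> ins (n, m, e)" "y \<in> ins (n, m, e)"
    and yz: "y \<in> clique (n', m', e')" "z \<in> clique (n', m', e')"
    and xz: "x \<in> clique (n'', m'', e'')" "z \<in> clique (n'', m'', e'')"
    and d: "distinct [x, y, z]"
  shows "n' = n \<and> m' = m \<and> n'' = n \<and> m'' = m"
proof -
  note irr1 = adjacent_irrefl[OF T1] and irr2 = adjacent_irrefl[OF T2]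
  note tri = tree_quiver_no_triangle[OF T2] and sq = tree_quiver_no_square[OF T2]
  note E = ins_ins[OF xy]
  have xy_ne: "snd x \<noteq> snd y" using d E by (auto simp: prod_eq_iff)
  have arc_m: "\<exists>b\<in>arcs T2. head T2 b = m \<and> tail T2 b = snd x"
    "\<exists>b\<in>arcs T2. head T2 b = m \<and> tail T2 b = snd y"
    using xy by (auto simp: ins_iff)
  consider (oo) "y \<in> outs (n', m', e')" "z \<in> outs (n', m', e')"
    | (ii) "y \<in> ins (n', m', e')" "z \<in> ins (n', m', e')"
    | (io) "y \<in> ins (n', m', e')" "z \<in> outs (n', m', e')"
    | (oi) "y \<in> outs (n', m', e')" "z \<in> ins (n', m', e')"
    using yz by (auto simp: clique_def)
  note c1 = this
  consider (oo) "x \<in> outs (n'', m'', e'')" "z \<in> outs (n'', m'', e'')"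
    | (ii) "x \<in> ins (n'', m'', e'')" "z \<in> ins (n'', m'', e'')"
    | (io) "x \<in> ins (n'', m'', e'')" "z \<in> outs (n'', m'', e'')"
    | (oi) "x \<in> outs (n'', m'', e'')" "z \<in> ins (n'', m'', e'')"
    using xz by (auto simp: clique_def)
  note c2 = this
  have arrow: "snd z = m \<and> fst z \<noteq> n" if "adjacent T2 (snd z) (snd x)" "adjacent T2 (snd z) (snd y)"
    "adjacent T1 (fst z) (fst x) \<or> adjacent T1 (fst z) (fst y)"
    using sq[OF that(1,2) E(3,4) xy_ne] that(3) E(1,2) irr1 by metis
  have no_arrow_out_of_m: "\<not> (u \<in> ins (n0, m0, e0) \<and> v \<in> outs (n0, m0, e0) \<and> snd u = m \<and>
      (snd v = snd x \<or> snd v = snd y))" for u v n0 m0 e0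
    using arc_m tree_quiver_no_antiparallel[OF T2] by (auto simp: ins_iff outs_iff) metis+
  from c1 show ?thesis
  proof cases
    case oo
    note A = outs_outs[OF oo]
    from c2 show ?thesis
    proof cases
      case oo then show ?thesis using outs_outs[OF oo] A E xy_ne by metis
    next
      case ii then show ?thesis using ins_ins[OF ii] A E d by (auto simp: prod_eq_iff)
    next
      case io then show ?thesis using ins_outs[OF io] A E tri adjacent_sym by metis
    next
      case oi then show ?thesis using ins_outs[OF oi(2,1)] A E tri adjacent_sym by metis
    qed
  next
    case ii
    note A = ins_ins[OF ii]
    from c2 show ?thesis
    proof cases
      case oo then show ?thesis using outs_outs[OF oo] A E d by (auto simp: prod_eq_iff)
    next
      case ii
      note B = ins_ins[OF ii]
      have dd: "distinct [snd x, snd y, snd z]" "distinct [snd y, snd x, snd z]"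
        using d A B E by (auto simp: prod_eq_iff)
      have "m = m'" by (rule tree_quiver_no_hexagon[OF T2 dd(1) E(3,4) A(3,4) B(3,4)])
      moreover have "m = m''" by (rule tree_quiver_no_hexagon[OF T2 dd(2) E(4,3) B(3,4) A(3,4)])
      ultimately show ?thesis using A B E by metis
    next
      case io then show ?thesis using ins_outs[OF io] A E irr1 by metis
    next
      case oi then show ?thesis using ins_outs[OF oi(2,1)] A E irr1 by metis
    qed
  next
    case io
    note A = ins_outs[OF io]
    from c2 show ?thesis
    proof cases
      case oo then show ?thesis using outs_outs[OF oo] A E tri adjacent_sym by metis
    next
      case ii then show ?thesis using ins_ins[OF ii] A E irr1 by metis
    next
      case c: io then show ?thesis using ins_outs[OF c] A E arrow adjacent_sym by metis
    next
      case oi then show ?thesis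
        using ins_outs[OF oi(2,1)] A arrow no_arrow_out_of_m adjacent_sym by metis
    qed
  next
    case oi
    note A = ins_outs[OF oi(2,1)]
    from c2 show ?thesis
    proof cases
      case oo then show ?thesis using outs_outs[OF oo] A E tri adjacent_sym by metis
    next
      case ii then show ?thesis using ins_ins[OF ii] A E irr1 by metis
    next
      case io then show ?thesis
        using ins_outs[OF io] A arrow no_arrow_out_of_m oi adjacent_sym by metis
    next
      case c: oi then show ?thesis
        using ins_outs[OF c(2,1)] A arrow no_arrow_out_of_m oi adjacent_sym by metis
    qed
  qed
qed

text \<open>A point with two labels would come from two parallel arrows, or from a loop if it is in
  \<open>outs\<close> for one label and in \<open>ins\<close> for the other.\<close>

lemma clique_label:
  assumes "x \<in> clique (n, m, e)" "x \<in> clique (n, m, e')"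
  shows "e = e'"
proof -
  have "e = e'" if "x \<in> outs (n, m, e)" "x \<in> outs (n, m, e')" for e e'
    using that tree_quiver_no_parallel[OF T1] unfolding outs_iff by (metis prod.inject)
  moreover have "e = e'" if "x \<in> ins (n, m, e)" "x \<in> ins (n, m, e')" for e e'
    using that tree_quiver_no_parallel[OF T2] unfolding ins_iff by (metis prod.inject)
  moreover have False if "x \<in> outs (n, m, e)" "x \<in> ins (n, m, e')" for e e'
    using that tree_quiver_no_loop[OF T1] unfolding outs_iff ins_iff by (metis prod.inject)
  ultimately show ?thesis using assms unfolding clique_def by blast
qed

text \<open>If some pair lies in one part of its clique, \<open>triangle_outs\<close> or
  \<open>triangle_ins\<close> applies after permuting the points; otherwise the first coordinates
  form a triangle in \<open>T1\<close>. Thus triangles of the pullback network stay inside one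
  clique, which is what \<open>R2_free\<close> requires.\<close>

lemma triangle_clique:
  assumes xy: "x \<in> clique C" "y \<in> clique C" and yz: "y \<in> clique C'" "z \<in> clique C'"
    and xz: "x \<in> clique C''" "z \<in> clique C''" and d: "distinct [x, y, z]"
  shows "C = C'"
proof -
  obtain n m e where C: "C = (n, m, e)" by (cases C)
  obtain n' m' e' where C': "C' = (n', m', e')" by (cases C')
  obtain n'' m'' e'' where C'': "C'' = (n'', m'', e'')" by (cases C'')
  have "n' = n \<and> m' = m"
  proof -
    consider "x \<in> outs C" "y \<in> outs C" | "y \<in> outs C'" "z \<in> outs C'" | "x \<in> outs C''" "z \<in> outs C''"
      | "x \<in> ins C" "y \<in> ins C" | "y \<in> ins C'" "z \<in> ins C'" | "x \<in> ins C''" "z \<in> ins C''"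
      | (mixed) "(x \<in> outs C \<and> y \<in> ins C) \<or> (x \<in> ins C \<and> y \<in> outs C)"
        "(y \<in> outs C' \<and> z \<in> ins C') \<or> (y \<in> ins C' \<and> z \<in> outs C')"
        "(x \<in> outs C'' \<and> z \<in> ins C'') \<or> (x \<in> ins C'' \<and> z \<in> outs C'')"
      using xy yz xz unfolding clique_def by blast
    then show ?thesis
    proof cases
      case 1 then show ?thesis using triangle_outs[of x n m e y n' m' e' z n'' m'' e''] assms C C' C'' by simp
    next
      case 2 then show ?thesis using triangle_outs[of y n' m' e' z n'' m'' e'' x n m e] assms C C' C'' by auto
    next
      case 3 then show ?thesis using triangle_outs[of x n'' m'' e'' z n' m' e' y n m e] assms C C' C'' by auto
    next
      case 4 then show ?thesis using triangle_ins[of x n m e y n' m' e' z n'' m'' e''] assms C C' C'' by simp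
    next
      case 5 then show ?thesis using triangle_ins[of y n' m' e' z n'' m'' e'' x n m e] assms C C' C'' by auto
    next
      case 6 then show ?thesis using triangle_ins[of x n'' m'' e'' z n' m' e' y n m e] assms C C' C'' by auto
    next
      case mixed
      have "adjacent T1 (fst u) (fst v)" if "(u \<in> outs D \<and> v \<in> ins D) \<or> (u \<in> ins D \<and> v \<in> outs D)" for u v D
        using that ins_outs(3) adjacent_sym by (cases D) blast
      then have "adjacent T1 (fst x) (fst y)" "adjacent T1 (fst y) (fst z)" "adjacent T1 (fst x) (fst z)"
        using mixed by blast+
      then show ?thesis using tree_quiver_no_triangle[OF T1] adjacent_sym by blast
    qed
  qed
  then show ?thesis using clique_label[of y n m e e'] xy(2) yz(1) C C' by simp
qed

section \<open>Links of the two networks in terms of cliques\<close>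

lemma pullback_edges: "edges PN =
    {{(n, m), (n', m)} | n n' m. (n, m) \<in> PV \<and> (n', m) \<in> PV \<and> n \<noteq> n' \<and>
       (\<exists>a\<in>arcs T1. \<exists>b\<in>arcs T1. tail T1 a = tail T1 b \<and>
          head T1 a = n \<and> head T1 b = n' \<and> amap F1 a = amap F1 b)} \<union>
    {{(n, m), (n, m')} | n m m'. (n, m) \<in> PV \<and> (n, m') \<in> PV \<and> m \<noteq> m' \<and>
       (\<exists>c\<in>arcs T2. \<exists>d\<in>arcs T2. head T2 c = head T2 d \<and>
          tail T2 c = m \<and> tail T2 d = m' \<and> amap F2 c = amap F2 d)}"
  by (simp only: pullback_network_def network.simps)

lemma covering_edges: "edges CN = {{(n, m, j), (n', m', -j)} | n m n' m' j.
    {(n, m), (n', m')} \<in> edges PN \<and> j \<in> {-1, 1}}"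
  by (simp only: covering_network_def Let_def network.simps)

lemma pullback_link_clique:
  assumes "link PN x y"
  shows "\<exists>C. x \<in> clique C \<and> y \<in> clique C"
proof -
  \<comment> \<open>The tail of \<open>(a, b)\<close> lies in \<open>ins\<close> and its head in
    \<open>outs\<close> of the clique with vertices \<open>tail T1 a\<close> and
    \<open>head T2 b\<close>.\<close>
  have arrow: "\<exists>C. (tail T1 a, tail T2 b) \<in> clique C \<and> (head T1 a, head T2 b) \<in> clique C"
    if "a \<in> arcs T1" "b \<in> arcs T2" "amap F1 a = amap F2 b" for a b
    using that unfolding clique_def
    by (intro exI[of _ "(tail T1 a, head T2 b, amap F1 a)"]) (auto simp: outs_iff ins_iff)
  have outs: "\<exists>C. (head T1 a, m) \<in> clique C \<and> (head T1 b, m) \<in> clique C"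
    if "a \<in> arcs T1" "b \<in> arcs T1" "tail T1 a = tail T1 b" "amap F1 a = amap F1 b" for a b m
    using that unfolding clique_def
    by (intro exI[of _ "(tail T1 a, m, amap F1 a)"]) (auto simp: outs_iff)
  have ins: "\<exists>C. (n, tail T2 c) \<in> clique C \<and> (n, tail T2 d) \<in> clique C"
    if "c \<in> arcs T2" "d \<in> arcs T2" "head T2 c = head T2 d" "amap F2 c = amap F2 d" for c d n
    using that unfolding clique_def
    by (intro exI[of _ "(n, head T2 c, amap F2 c)"]) (auto simp: ins_iff)
  consider (arc) ab where "ab \<in> arcs PN" "{x, y} = {tail PN ab, head PN ab}" | (edge) "{x, y} \<in> edges PN"
    using assms unfolding link_def by blast
  then have "\<exists>u v C. {x, y} = {u, v} \<and> u \<in> clique C \<and> v \<in> clique C"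
  proof cases
    case arc
    then obtain a b where "a \<in> arcs T1" "b \<in> arcs T2" "amap F1 a = amap F2 b"
      "{x, y} = {(tail T1 a, tail T2 b), (head T1 a, head T2 b)}"
      by (cases ab) (auto simp: pullback_network_def)
    then show ?thesis using arrow[of a b] by blast
  next
    case edge
    then consider
      (o) a b n n' m where "a \<in> arcs T1" "b \<in> arcs T1" "tail T1 a = tail T1 b" "amap F1 a = amap F1 b"
        "{x, y} = {(n, m), (n', m)}" "head T1 a = n" "head T1 b = n'"
      | (i) c d n m m' where "c \<in> arcs T2" "d \<in> arcs T2" "head T2 c = head T2 d" "amap F2 c = amap F2 d"
        "{x, y} = {(n, m), (n, m')}" "tail T2 c = m" "tail T2 d = m'"
      unfolding pullback_edges Un_iff mem_Collect_eq by blast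
    then show ?thesis
    proof cases
      case o
      then show ?thesis using outs[OF o(1-4), of m] by blast
    next
      case i
      then show ?thesis using ins[OF i(1-4), of n] by blast
    qed
  qed
  then show ?thesis by (auto simp: doubleton_eq_iff)
qed

lemma lift_in_CN: "lift x j \<in> verts CN \<longleftrightarrow> x \<in> PV \<and> j \<in> {-1, 1}"
  by (cases x) (simp add: lift_def covering_network_def pullback_network_def)

lemma pullback_edgeI:
  assumes "x \<in> PV" "y \<in> PV" "x \<noteq> y" "x \<in> outs C \<and> y \<in> outs C \<or> x \<in> ins C \<and> y \<in> ins C"
  shows "{x, y} \<in> edges PN"
proof -
  obtain n m e where C: "C = (n, m, e)" by (cases C)
  show ?thesis
  proof (cases "x \<in> outs C \<and> y \<in> outs C")
    case True
    then obtain a b where "a \<in> arcs T1" "b \<in> arcs T1" "tail T1 a = n" "tail T1 b = n"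
      "amap F1 a = e" "amap F1 b = e" "x = (head T1 a, m)" "y = (head T1 b, m)"
      unfolding C outs_iff by blast
    note ab = this assms(1-3)
    show ?thesis unfolding pullback_edges
      by (rule UnI1, rule CollectI, rule exI[of _ "head T1 a"], rule exI[of _ "head T1 b"],
          rule exI[of _ m], use ab in \<open>auto; metis\<close>)
  next
    case False
    then obtain a b where "a \<in> arcs T2" "b \<in> arcs T2" "head T2 a = m" "head T2 b = m"
      "amap F2 a = e" "amap F2 b = e" "x = (n, tail T2 a)" "y = (n, tail T2 b)"
      using assms(4) unfolding C ins_iff by blast
    note ab = this assms(1-3)
    show ?thesis unfolding pullback_edges
      by (rule UnI2, rule CollectI, rule exI[of _ n], rule exI[of _ "tail T2 a"],
          rule exI[of _ "tail T2 b"], use ab in \<open>auto; metis\<close>)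
  qed
qed

lemma covering_edgeI:
  assumes "{x, y} \<in> edges PN" "j \<in> {-1, 1}"
  shows "{lift x j, lift y (- j)} \<in> edges CN"
proof -
  have E: "{(fst x, snd x), (fst y, snd y)} \<in> edges PN" using assms(1) by simp
  show ?thesis unfolding covering_edges lift_def
    by (rule CollectI, rule exI[of _ "fst x"], rule exI[of _ "snd x"], rule exI[of _ "fst y"],
        rule exI[of _ "snd y"], rule exI[of _ j], intro conjI refl E assms(2))
qed

lemma covering_arcI:
  assumes "a \<in> arcs T1" "b \<in> arcs T2" "amap F1 a = amap F2 b" "j \<in> {-1, 1}"
  shows "(a, b, j) \<in> arcs CN"
  using assms by (simp add: covering_network_def pullback_network_def Let_def)

lemma covering_tail: "tail CN (a, b, j) = lift (tail T1 a, tail T2 b) j"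
  and covering_head: "head CN (a, b, j) = lift (head T1 a, head T2 b) j"
  by (simp_all add: covering_network_def Let_def lift_def)

text \<open>The matrix entry at \<open>x\<close> of the map attached to a network with vertex set
  \<open>W\<close>: the sum of the sheets on which \<open>W\<close> contains a lift of
  \<open>x\<close>.\<close>

definition signed_count :: "(nat \<times> nat \<times> int) set \<Rightarrow> nat \<times> nat \<Rightarrow> 'k::field" where
  "signed_count W x = (if lift x 1 \<in> W then 1 else 0) - (if lift x (- 1) \<in> W then 1 else 0)"

definition solution :: "(nat \<times> nat \<Rightarrow> 'k::field) \<Rightarrow> bool" where
  "solution h \<longleftrightarrow> (\<forall>C. (\<Sum>x\<in>clique C. of_int (side C x) * h x) = 0)"

text \<open>A stopping set in the sense of coding theory: no equation of the system in
  \<open>solution\<close> involves exactly one variable of \<open>X\<close>.\<close>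

definition stopping :: "(nat \<times> nat) set \<Rightarrow> bool" where
  "stopping X \<longleftrightarrow> (\<forall>C. \<forall>x\<in>X \<inter> clique C. \<exists>y\<in>X \<inter> clique C. y \<noteq> x)"

end

section \<open>Fixed-point-free permutations of cliques\<close>

declare split_paired_Ex [simp del] split_paired_All [simp del]

lemma ex_derangement:
  assumes "finite A" "card A \<noteq> 1"
  shows "\<exists>f. bij_betw f A A \<and> (\<forall>x\<in>A. f x \<noteq> x)"
proof -
  obtain g where g: "bij_betw g {0..<card A} A"
    using ex_bij_betw_nat_finite[OF assms(1)] by blast
  define s where "s i = Suc i mod card A" for i
  have s_in: "s i \<in> {0..<card A}" and s_ne: "s i \<noteq> i" if "i \<in> {0..<card A}" for i
    using that assms(2) by (auto simp: s_def mod_Suc)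
  have "inj_on s {0..<card A}"
    by (auto simp: inj_on_def s_def mod_Suc split: if_splits)
  then have s: "bij_betw s {0..<card A} {0..<card A}"
    using s_in by (intro bij_betw_imageI endo_inj_surj) auto
  let ?f = "g \<circ> s \<circ> the_inv_into {0..<card A} g"
  have "bij_betw ?f A A"
    using bij_betw_the_inv_into[OF g] s g by (blast intro: bij_betw_trans)
  moreover have "?f x \<noteq> x" if "x \<in> A" for x
  proof -
    have "the_inv_into {0..<card A} g x \<in> {0..<card A}" "g (the_inv_into {0..<card A} g x) = x"
      using that g bij_betw_the_inv_into[OF g] f_the_inv_into_f_bij_betw[OF g]
      by (auto simp: bij_betw_def)
    then show ?thesis
      using s_in s_ne g by (metis bij_betw_inv_into_left comp_apply)
  qed
  ultimately show ?thesis by blast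
qed

locale clique_derangement = tree_pair T1 F1 T2 F2 Q
  for T1 :: "(nat, 'a) pre_digraph" and F1 :: "('a, 'v, 'e) quiver_map"
    and T2 :: "(nat, 'b) pre_digraph" and F2 :: "('b, 'v, 'e) quiver_map"
    and Q :: "('v, 'e) pre_digraph" +
  fixes S :: "(nat \<times> nat) set" and \<sigma> :: "nat \<times> nat \<times> 'e \<Rightarrow> nat \<times> nat \<Rightarrow> nat \<times> nat"
  assumes S_sub: "S \<subseteq> PV"
    and bij: "bij_betw (\<sigma> C) (S \<inter> clique C) (S \<inter> clique C)"
    and no_fix: "x \<in> S \<inter> clique C \<Longrightarrow> \<sigma> C x \<noteq> x"
begin

section \<open>The pairing on the lifts of \<open>S\<close>\<close>

definition cover :: "(nat \<times> nat \<times> int) set" where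
  "cover = {u. sheet_proj u \<in> S \<and> sheet u \<in> {-1, 1}}"

text \<open>Opposite values of \<open>side * sheet\<close> are what makes links within \<open>outs\<close> or within \<open>ins\<close>
  change the sheet, as edges do, and links between \<open>ins\<close> and \<open>outs\<close> preserve it, as arrows do.\<close>

definition matched :: "nat \<times> nat \<times> 'e \<Rightarrow> nat \<times> nat \<times> int \<Rightarrow> nat \<times> nat \<times> int \<Rightarrow> bool" where
  "matched C u v \<longleftrightarrow> sheet_proj u \<in> S \<inter> clique C \<and> sheet_proj v = \<sigma> C (sheet_proj u) \<and>
     sheet u = side C (sheet_proj u) \<and> sheet v = - side C (sheet_proj v)"

text \<open>For fixed \<open>C\<close> this is a perfect matching on the part of
  \<open>cover\<close> over \<open>S \<inter> clique C\<close>: with signed value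
  \<open>side * sheet\<close>, the lift of \<open>x\<close> of value 1 has its partner over
  \<open>\<sigma> C x\<close>, the lift of value -1 over the preimage of \<open>x\<close> under
  \<open>\<sigma> C\<close>.\<close>

definition paired :: "nat \<times> nat \<times> 'e \<Rightarrow> nat \<times> nat \<times> int \<Rightarrow> nat \<times> nat \<times> int \<Rightarrow> bool" where
  "paired C u v \<longleftrightarrow> matched C u v \<or> matched C v u"

definition pairing_closed :: "(nat \<times> nat \<times> int) set \<Rightarrow> bool" where
  "pairing_closed W \<longleftrightarrow> W \<subseteq> cover \<and> (\<forall>C. \<forall>u\<in>W. \<forall>v. paired C u v \<longrightarrow> v \<in> W)"

text \<open>Keeping only paired links leaves every vertex at most one neighbour for each clique;
  \<open>R2_free\<close> rests on this.\<close>

definition net :: "(nat \<times> nat \<times> int) set \<Rightarrow> (nat \<times> nat \<times> int, 'a \<times> 'b \<times> int) network" where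
  "net W = \<lparr>verts = W,
     arcs = {e \<in> arcs CN. tail CN e \<in> W \<and> head CN e \<in> W \<and> (\<exists>C. paired C (tail CN e) (head CN e))},
     tail = tail CN, head = head CN,
     edges = {{u, v} | u v. {u, v} \<in> edges CN \<and> u \<in> W \<and> v \<in> W \<and> (\<exists>C. paired C u v)}\<rparr>"

lemma net_simps: "verts (net W) = W" "tail (net W) = tail CN" "head (net W) = head CN"
  by (simp_all add: net_def)

lemma net_edgeI:
  assumes "{u, v} \<in> edges CN" "paired C u v" "u \<in> W" "v \<in> W"
  shows "{u, v} \<in> edges (net W)"
proof -
  have "\<exists>C. paired C u v" using assms(2) by blast
  then show ?thesis unfolding net_def network.simps
    by (intro CollectI) (rule exI[of _ u], rule exI[of _ v], intro conjI refl assms)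
qed

lemma sheet_eqI: "sheet_proj u = sheet_proj v \<Longrightarrow> sheet u = sheet v \<Longrightarrow> u = v"
  by (metis lift_sheet_proj)

lemma \<sigma>_in: "x \<in> S \<inter> clique C \<Longrightarrow> \<sigma> C x \<in> S \<inter> clique C"
  using bij[of C] by (auto simp: bij_betw_def)

lemma paired_sym: "paired C u v \<Longrightarrow> paired C v u"
  by (auto simp: paired_def)

lemma pairedD:
  assumes "paired C u v"
  shows "sheet_proj u \<in> S \<inter> clique C" "sheet_proj v \<in> S \<inter> clique C" "sheet_proj u \<noteq> sheet_proj v"
    "sheet v = - side C (sheet_proj u) * side C (sheet_proj v) * sheet u"
    "u \<in> cover" "v \<in> cover"
proof -
  have *: "sheet_proj u \<in> S \<inter> clique C \<and> sheet_proj v \<in> S \<inter> clique C \<and> sheet_proj u \<noteq> sheet_proj v"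
    using assms \<sigma>_in no_fix unfolding paired_def matched_def by metis
  then show "sheet_proj u \<in> S \<inter> clique C" "sheet_proj v \<in> S \<inter> clique C" "sheet_proj u \<noteq> sheet_proj v"
    by auto
  show "sheet v = - side C (sheet_proj u) * side C (sheet_proj v) * sheet u"
    using assms side_cases[of C "sheet_proj u"] side_cases[of C "sheet_proj v"]
    unfolding paired_def matched_def by auto
  show "u \<in> cover" "v \<in> cover"
    using assms * side_cases[of C "sheet_proj u"] side_cases[of C "sheet_proj v"]
    unfolding paired_def matched_def cover_def by auto
qed

text \<open>The sheet of \<open>v\<close> decides whether \<open>v\<close> is the first or the
  second argument of \<open>matched C\<close>; the other argument is then determined, because
  \<open>\<sigma> C\<close> is a function in the one case and injective in the other.\<close>

lemma paired_unique:
  assumes "paired C u v" "paired C w v"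
  shows "u = w"
proof -
  have no_both: "\<not> (matched C x v \<and> matched C v y)" for x y
    using side_cases[of C "sheet_proj v"] by (auto simp: matched_def)
  have "sheet_proj u = sheet_proj w \<and> sheet u = sheet w"
  proof (cases "matched C u v")
    case True
    then have "matched C w v" using assms no_both unfolding paired_def by blast+
    moreover have "inj_on (\<sigma> C) (S \<inter> clique C)" using bij by (simp add: bij_betw_def)
    ultimately have "sheet_proj u = sheet_proj w"
      using True unfolding matched_def by (metis (no_types) inj_on_eq_iff)
    then show ?thesis using True \<open>matched C w v\<close> unfolding matched_def by metis
  next
    case False
    then have "matched C v u" "matched C v w" using assms no_both unfolding paired_def by blast+
    then show ?thesis unfolding matched_def by metis
  qed
  then show ?thesis by (intro sheet_eqI) auto
qed

lemma paired_exists: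
  assumes "u \<in> cover" "sheet_proj u \<in> clique C"
  shows "\<exists>v. paired C u v"
proof -
  let ?x = "sheet_proj u"
  have x: "?x \<in> S \<inter> clique C" using assms by (simp add: cover_def)
  then obtain y where y: "y \<in> S \<inter> clique C" "\<sigma> C y = ?x"
    using bij[of C] unfolding bij_betw_def by (metis imageE)
  have "sheet u = side C ?x \<or> sheet u = - side C ?x"
    using assms(1) side_cases[of C ?x] by (auto simp: cover_def)
  then show ?thesis
  proof
    assume "sheet u = side C ?x"
    then have "matched C u (lift (\<sigma> C ?x) (- side C (\<sigma> C ?x)))" using x by (simp add: matched_def)
    then show ?thesis by (auto simp: paired_def)
  next
    assume "sheet u = - side C ?x"
    then have "matched C (lift y (side C y)) u" using y by (simp add: matched_def)
    then show ?thesis by (auto simp: paired_def)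
  qed
qed

lemma paired_same_side:
  assumes p: "paired C u v"
    and s: "sheet_proj u \<in> outs C \<and> sheet_proj v \<in> outs C \<or> sheet_proj u \<in> ins C \<and> sheet_proj v \<in> ins C"
  shows "sheet v = - sheet u" "{u, v} \<in> edges CN"
proof -
  note P = pairedD[OF p]
  have "side C (sheet_proj u) * side C (sheet_proj v) = 1"
    using s outs_ins_disjoint[of C] by (auto simp: side_def)
  then show sh: "sheet v = - sheet u" using P(4) by simp
  have "{sheet_proj u, sheet_proj v} \<in> edges PN"
    using P(1-3) S_sub s by (intro pullback_edgeI[of _ _ C]) auto
  moreover have "sheet u \<in> {-1, 1}" using P(5) by (simp add: cover_def)
  ultimately have "{lift (sheet_proj u) (sheet u), lift (sheet_proj v) (- sheet u)} \<in> edges CN"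
    by (rule covering_edgeI)
  then show "{u, v} \<in> edges CN" using sh by (metis lift_sheet_proj)
qed

lemma paired_ins_outs:
  assumes p: "paired (n, m, e) u v"
    and s: "sheet_proj u \<in> ins (n, m, e)" "sheet_proj v \<in> outs (n, m, e)"
  shows "sheet u = sheet v"
    and "\<exists>a\<in>arcs T1. \<exists>b\<in>arcs T2. tail T1 a = n \<and> head T2 b = m \<and> amap F1 a = e \<and> amap F2 b = e \<and>
      (a, b, sheet u) \<in> arcs CN \<and> tail CN (a, b, sheet u) = u \<and> head CN (a, b, sheet u) = v"
proof -
  note P = pairedD[OF p]
  have "side (n, m, e) (sheet_proj u) * side (n, m, e) (sheet_proj v) = -1"
    using s outs_ins_disjoint[of "(n, m, e)"] by (auto simp: side_def)
  then show sh: "sheet u = sheet v" using P(4) by simp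
  obtain a b where ab: "a \<in> arcs T1" "b \<in> arcs T2" "tail T1 a = n" "head T2 b = m"
    "amap F1 a = e" "amap F2 b = e" "sheet_proj u = (n, tail T2 b)" "sheet_proj v = (head T1 a, m)"
    using s unfolding outs_iff ins_iff by blast
  have "sheet u \<in> {-1, 1}" using P(5) by (simp add: cover_def)
  then have "(a, b, sheet u) \<in> arcs CN" using covering_arcI ab by simp
  moreover have "tail CN (a, b, sheet u) = u" "head CN (a, b, sheet u) = v"
    unfolding covering_tail covering_head using ab sh by (metis lift_sheet_proj)+
  ultimately show "\<exists>a\<in>arcs T1. \<exists>b\<in>arcs T2. tail T1 a = n \<and> head T2 b = m \<and> amap F1 a = e \<and> amap F2 b = e \<and>
      (a, b, sheet u) \<in> arcs CN \<and> tail CN (a, b, sheet u) = u \<and> head CN (a, b, sheet u) = v"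
    using ab by blast
qed

text \<open>Every pair is realised by a link of the covering network: by an edge if both points lie
  in the same part of the clique, otherwise by an arrow from the \<open>ins\<close> point to the
  \<open>outs\<close> point. Closedness puts the partner into \<open>W\<close>.\<close>

lemma link_net_iff:
  assumes W: "pairing_closed W"
  shows "link (net W) u v \<longleftrightarrow> u \<in> W \<and> (\<exists>C. paired C u v)"
proof
  assume "link (net W) u v"
  then consider e where "e \<in> arcs (net W)" "(tail CN e = u \<and> head CN e = v) \<or> (tail CN e = v \<and> head CN e = u)"
    | "{u, v} \<in> edges (net W)"
    unfolding link_def net_simps by blast
  then show "u \<in> W \<and> (\<exists>C. paired C u v)"
  proof cases
    case 1
    then have "tail CN e \<in> W" "head CN e \<in> W" "\<exists>C. paired C (tail CN e) (head CN e)"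
      by (simp_all add: net_def)
    then show ?thesis using 1(2) paired_sym by metis
  next
    case 2
    then obtain u' v' where "{u, v} = {u', v'}" "u' \<in> W" "v' \<in> W" "\<exists>C. paired C u' v'"
      unfolding net_def network.simps mem_Collect_eq by blast
    then show ?thesis using paired_sym unfolding doubleton_eq_iff by blast
  qed
next
  assume "u \<in> W \<and> (\<exists>C. paired C u v)"
  then obtain C where u: "u \<in> W" and p: "paired C u v" by blast
  have v: "v \<in> W" using W u p by (auto simp: pairing_closed_def)
  obtain n m e where C: "C = (n, m, e)" by (cases C)
  have arrow: "\<exists>a\<in>arcs (net W). tail (net W) a = x \<and> head (net W) a = y"
    if "paired C x y" "x \<in> W" "y \<in> W" "sheet_proj x \<in> ins C" "sheet_proj y \<in> outs C" for x y
    using paired_ins_outs(2)[of n m e x y] that C unfolding net_def by fastforce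
  consider "sheet_proj u \<in> outs C \<and> sheet_proj v \<in> outs C \<or> sheet_proj u \<in> ins C \<and> sheet_proj v \<in> ins C"
    | "sheet_proj u \<in> ins C" "sheet_proj v \<in> outs C" | "sheet_proj u \<in> outs C" "sheet_proj v \<in> ins C"
    using pairedD(1,2)[OF p] by (auto simp: clique_def)
  then show "link (net W) u v"
  proof cases
    case 1
    have "{u, v} \<in> edges (net W)" using paired_same_side(2)[OF p 1] p u v by (rule net_edgeI)
    then show ?thesis by (simp add: link_def)
  next
    case 2
    then show ?thesis using arrow[OF p u v] unfolding link_def by blast
  next
    case 3
    then show ?thesis using arrow[OF paired_sym[OF p] v u] unfolding link_def by blast
  qed
qed

lemma subnetwork_net:
  assumes "pairing_closed W"
  shows "subnetwork (net W) CN"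
proof -
  have "u \<in> verts CN" if "u \<in> cover" for u
    using that S_sub lift_in_CN[of "sheet_proj u" "sheet u"] by (auto simp: cover_def)
  then have "W \<subseteq> verts CN" using assms by (auto simp: pairing_closed_def)
  moreover have "network (net W)"
    using pairedD(3) by (auto simp: network_def net_def card_2_iff) metis
  ultimately show ?thesis by (auto simp: subnetwork_def net_def)
qed

text \<open>For an arrow \<open>a\<close> into \<open>n\<close>, the point \<open>(n, m)\<close>
  lies in \<open>outs\<close> of the clique \<open>(tail T1 a, m, amap F1 a)\<close>. Its partner
  there supplies the required edge if it lies in \<open>outs\<close>, and the required arrow if it
  lies in \<open>ins\<close>. Arrows out of \<open>m\<close> are dual, with the clique
  \<open>(n, head T2 b, amap F2 b)\<close>.\<close>

lemma complete_net:
  assumes W: "pairing_closed W"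
  shows "complete T1 F1 T2 F2 (net W)"
proof -
  have partner: "\<exists>v\<in>W. paired C u v" if "u \<in> W" "sheet_proj u \<in> clique C" for u C
    using that W paired_exists unfolding pairing_closed_def by blast
  have arc_in: "a \<in> arcs (net W)" if "a \<in> arcs CN" "paired C (tail CN a) (head CN a)" "tail CN a \<in> W" for a C
    using that W unfolding net_def pairing_closed_def by auto
  have edge_in: "{u, v} \<in> edges (net W)" if "{u, v} \<in> edges CN" "paired C u v" "u \<in> W" for u v C
    using that W net_edgeI unfolding pairing_closed_def by blast
  have 1: "(\<exists>b\<in>arcs T2. head T2 b = m \<and> (a, b, j) \<in> arcs (net W)) \<or>
        (\<exists>c\<in>arcs T1. tail T1 c = tail T1 a \<and> amap F1 a = amap F1 c \<and>
           (head T1 c, m, -j) \<in> W \<and> {(n, m, j), (head T1 c, m, -j)} \<in> edges (net W))"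
    if u: "(n, m, j) \<in> W" and a: "a \<in> arcs T1" "head T1 a = n" for n m j a
  proof -
    let ?u = "(n, m, j)" and ?C = "(tail T1 a, m, amap F1 a)"
    have pu: "sheet_proj ?u = (n, m)" "sheet ?u = j" by (auto simp: sheet_proj_def sheet_def)
    have uo: "sheet_proj ?u \<in> outs ?C" using a pu by (auto simp: outs_iff)
    then obtain v where v: "v \<in> W" "paired ?C ?u v"
      using partner[OF u, of ?C] by (auto simp: clique_def)
    show ?thesis
    proof (cases "sheet_proj v \<in> outs ?C")
      case True
      then obtain c where c: "c \<in> arcs T1" "tail T1 c = tail T1 a" "amap F1 c = amap F1 a"
        "sheet_proj v = (head T1 c, m)" by (auto simp: outs_iff)
      note s = paired_same_side[OF v(2), OF disjI1[OF conjI[OF uo True]]]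
      have "v = (head T1 c, m, - j)"
        using c(4) s(1) pu lift_sheet_proj[of v] by (simp add: lift_def)
      then show ?thesis using c v(1) edge_in[OF s(2) v(2) u] by metis
    next
      case False
      then have vi: "sheet_proj v \<in> ins ?C" using pairedD(2)[OF v(2)] by (auto simp: clique_def)
      note s = paired_ins_outs[OF paired_sym[OF v(2)] vi uo]
      obtain a' b where ab: "a' \<in> arcs T1" "b \<in> arcs T2" "tail T1 a' = tail T1 a" "head T2 b = m"
        "(a', b, sheet v) \<in> arcs CN" "tail CN (a', b, sheet v) = v" "head CN (a', b, sheet v) = ?u"
        using s(2) by blast
      \<comment> \<open>Completeness asks for the given arrow \<open>a\<close>; \<open>a'\<close>
        shares both endpoints with it, and parallel arrows are excluded.\<close>
      have "head T1 a' = head T1 a" using ab(7) a by (simp add: covering_head lift_def)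
      then have "a' = a" using tree_quiver_no_parallel[OF T1] ab(1,3) a(1) by blast
      moreover have "(a', b, sheet v) \<in> arcs (net W)"
        using ab v paired_sym by (intro arc_in[of _ ?C]) auto
      ultimately show ?thesis using ab s(1) pu by auto
    qed
  qed
  have 2: "(\<exists>a\<in>arcs T1. tail T1 a = n \<and> (a, b, j) \<in> arcs (net W)) \<or>
        (\<exists>d\<in>arcs T2. head T2 d = head T2 b \<and> amap F2 b = amap F2 d \<and>
           (n, tail T2 d, -j) \<in> W \<and> {(n, m, j), (n, tail T2 d, -j)} \<in> edges (net W))"
    if u: "(n, m, j) \<in> W" and b: "b \<in> arcs T2" "tail T2 b = m" for n m j b
  proof -
    let ?u = "(n, m, j)" and ?C = "(n, head T2 b, amap F2 b)"
    have pu: "sheet_proj ?u = (n, m)" "sheet ?u = j" by (auto simp: sheet_proj_def sheet_def)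
    have ui: "sheet_proj ?u \<in> ins ?C" using b pu by (auto simp: ins_iff)
    then obtain v where v: "v \<in> W" "paired ?C ?u v"
      using partner[OF u, of ?C] by (auto simp: clique_def)
    show ?thesis
    proof (cases "sheet_proj v \<in> ins ?C")
      case True
      then obtain d where d: "d \<in> arcs T2" "head T2 d = head T2 b" "amap F2 d = amap F2 b"
        "sheet_proj v = (n, tail T2 d)" by (auto simp: ins_iff)
      note s = paired_same_side[OF v(2), OF disjI2[OF conjI[OF ui True]]]
      have "v = (n, tail T2 d, - j)"
        using d(4) s(1) pu lift_sheet_proj[of v] by (simp add: lift_def)
      then show ?thesis using d v(1) edge_in[OF s(2) v(2) u] by metis
    next
      case False
      then have vo: "sheet_proj v \<in> outs ?C" using pairedD(2)[OF v(2)] by (auto simp: clique_def)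
      note s = paired_ins_outs[OF v(2) ui vo]
      obtain a b' where ab: "a \<in> arcs T1" "b' \<in> arcs T2" "tail T1 a = n" "head T2 b' = head T2 b"
        "(a, b', sheet ?u) \<in> arcs CN" "tail CN (a, b', sheet ?u) = ?u" "head CN (a, b', sheet ?u) = v"
        using s(2) by blast
      have "tail T2 b' = tail T2 b" using ab(6) b by (simp add: covering_tail lift_def)
      then have "b' = b" using tree_quiver_no_parallel[OF T2] ab(2,4) b(1) by blast
      moreover have "(a, b', sheet ?u) \<in> arcs (net W)"
        using ab v u by (intro arc_in[of _ ?C]) auto
      ultimately show ?thesis using ab pu by auto
    qed
  qed
  show ?thesis unfolding complete_def net_simps
    by (intro ballI case_prodI2 conjI impI; hypsubst; rule 1 2; assumption?) simp_all
qed

text \<open>By \<open>triangle_clique\<close> both links at \<open>y\<close> would come from the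
  same clique, but there \<open>y\<close> has only one partner.\<close>

lemma R2_free_net:
  assumes W: "pairing_closed W"
  shows "R2_free T1 F1 T2 F2 (net W)"
  unfolding R2_free_def Let_def
proof (intro notI, elim bexE conjE)
  fix x y z
  assume l: "link (net W) x y" "link (net W) y z"
    and d: "distinct [sheet_proj x, sheet_proj y, sheet_proj z]"
    and xz: "link PN (sheet_proj x) (sheet_proj z)"
  obtain C C' where C: "paired C x y" "paired C' y z" using l link_net_iff[OF W] by blast
  obtain C'' where C'': "sheet_proj x \<in> clique C''" "sheet_proj z \<in> clique C''"
    using pullback_link_clique[OF xz] by blast
  have "C = C'"
    by (rule triangle_clique[of "sheet_proj x" C "sheet_proj y" C' "sheet_proj z" C''])
      (use pairedD[OF C(1)] pairedD[OF C(2)] C'' d in auto)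
  then have "x = z" using paired_unique C paired_sym by blast
  then show False using d by simp
qed

section \<open>Connected components of the pairing\<close>

definition component :: "nat \<times> nat \<times> int \<Rightarrow> (nat \<times> nat \<times> int) set" where
  "component u = {v. (\<lambda>u v. \<exists>C. paired C u v)\<^sup>*\<^sup>* u v}"

lemma pairing_closed_component:
  assumes "u \<in> cover"
  shows "pairing_closed (component u)"
proof -
  have "v \<in> cover" if "(\<lambda>u v. \<exists>C. paired C u v)\<^sup>*\<^sup>* u v" for v
    using that by (induction rule: rtranclp_induct) (use assms pairedD in auto)
  moreover have "w \<in> component u" if "v \<in> component u" "paired C v w" for v w C
    using that unfolding component_def by (auto intro: rtranclp.rtrancl_into_rtrancl)
  ultimately show ?thesis unfolding pairing_closed_def component_def by blast
qed

lemma connected_net_component: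
  assumes "u \<in> cover"
  shows "network_connected (net (component u))"
proof -
  let ?R = "\<lambda>u v. \<exists>C. paired C u v" and ?L = "link (net (component u))"
  note L = link_net_iff[OF pairing_closed_component[OF assms]]
  have reach: "?L\<^sup>*\<^sup>* u v" if "?R\<^sup>*\<^sup>* u v" for v
    using that
  proof (induction rule: rtranclp_induct)
    case (step v w)
    then have "?L v w" using L by (auto simp: component_def)
    with step.IH show ?case by (rule rtranclp.rtrancl_into_rtrancl)
  qed simp
  have "symp ?L" unfolding symp_def L using pairing_closed_component[OF assms] paired_sym
    unfolding pairing_closed_def by blast
  then have reach_back: "?L\<^sup>*\<^sup>* v u" if "?R\<^sup>*\<^sup>* u v" for v
    using sympD[OF symp_rtranclp reach[OF that]] by blast
  show ?thesis unfolding network_connected_def net_simps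
  proof (intro ballI)
    fix v w assume "v \<in> component u" "w \<in> component u"
    then have "?R\<^sup>*\<^sup>* u v" "?R\<^sup>*\<^sup>* u w" by (simp_all add: component_def)
    then show "?L\<^sup>*\<^sup>* v w" by (rule rtranclp_trans[OF reach_back reach])
  qed
qed

text \<open>The partner of a vertex in \<open>C\<close> lies over a different point of
  \<open>S \<inter> clique C\<close>, since \<open>\<sigma> C\<close> has no fixed point.\<close>

lemma stopping_sheet_proj:
  assumes "pairing_closed W"
  shows "stopping (sheet_proj ` W)" "sheet_proj ` W \<subseteq> S"
proof -
  show "sheet_proj ` W \<subseteq> S" using assms by (auto simp: pairing_closed_def cover_def)
  show "stopping (sheet_proj ` W)" unfolding stopping_def
  proof (intro allI ballI)
    fix C x assume x: "x \<in> sheet_proj ` W \<inter> clique C"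
    then obtain u where u: "u \<in> W" "x = sheet_proj u" by blast
    then obtain v where v: "paired C u v" using assms x paired_exists unfolding pairing_closed_def by blast
    then have "v \<in> W" using assms u by (auto simp: pairing_closed_def)
    then show "\<exists>y\<in>sheet_proj ` W \<inter> clique C. y \<noteq> x" using pairedD[OF v] u
      by (intro bexI[of _ "sheet_proj v"]) auto
  qed
qed

text \<open>In each clique \<open>\<sigma> C\<close> maps the points whose lift of signed value 1
  lies in \<open>W\<close> bijectively onto those whose lift of signed value -1 lies in
  \<open>W\<close>, so the contributions to the equation cancel.\<close>

lemma solution_signed_count:
  assumes W: "pairing_closed W"
  shows "solution (signed_count W :: nat \<times> nat \<Rightarrow> 'k::field)"
  unfolding solution_def
proof
  fix C
  let ?P = "{x \<in> clique C. lift x (side C x) \<in> W}" and ?N = "{x \<in> clique C. lift x (- side C x) \<in> W}"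
  have PS: "x \<in> S" if "lift x j \<in> W" for x j using that W by (force simp: pairing_closed_def cover_def)
  have "bij_betw (\<sigma> C) ?P ?N"
  proof (rule bij_betw_imageI)
    show "inj_on (\<sigma> C) ?P" using bij[of C] PS by (auto simp: bij_betw_def intro: inj_on_subset)
    show "\<sigma> C ` ?P = ?N"
    proof (intro equalityI subsetI)
      fix y assume "y \<in> \<sigma> C ` ?P"
      then obtain x where x: "x \<in> clique C" "lift x (side C x) \<in> W" "y = \<sigma> C x" by blast
      then have "paired C (lift x (side C x)) (lift y (- side C y))"
        using PS by (auto simp: paired_def matched_def)
      then show "y \<in> ?N" using W x pairedD(2) unfolding pairing_closed_def by fastforce
    next
      fix y assume y: "y \<in> ?N"
      then have "y \<in> S \<inter> clique C" using PS by blast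
      then obtain x where x: "x \<in> S \<inter> clique C" "y = \<sigma> C x"
        using bij[of C] unfolding bij_betw_def by (metis imageE)
      then have "paired C (lift y (- side C y)) (lift x (side C x))"
        by (auto simp: paired_def matched_def)
      then show "y \<in> \<sigma> C ` ?P" using W x y unfolding pairing_closed_def by blast
    qed
  qed
  then have card: "card ?P = card ?N" by (rule bij_betw_same_card)
  \<comment> \<open>Multiplication by \<open>side\<close> sorts the two lifts of \<open>x\<close> by
    signed value instead of by sheet.\<close>
  have "(\<Sum>x\<in>clique C. of_int (side C x) * signed_count W x) =
    (\<Sum>x\<in>clique C. (if lift x (side C x) \<in> W then 1 else 0) - (if lift x (- side C x) \<in> W then 1 else (0::'k)))"
  proof (rule sum.cong)
    fix x show "of_int (side C x) * signed_count W x = (if lift x (side C x) \<in> W then 1 else 0) -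
        (if lift x (- side C x) \<in> W then 1 else (0::'k))"
      using side_cases[of C x] by (auto simp: signed_count_def)
  qed simp
  also have "\<dots> = of_nat (card ?P) - of_nat (card ?N)"
    using finite_clique(3)[of C] by (simp add: sum_subtractf sum.If_cases Int_def)
  finally show "(\<Sum>x\<in>clique C. of_int (side C x) * signed_count W x) = (0::'k)" using card by simp
qed

lemma component_sym:
  assumes "v \<in> component u"
  shows "u \<in> component v"
proof -
  have "symp (\<lambda>u v. \<exists>C. paired C u v)" using paired_sym unfolding symp_def by blast
  from sympD[OF symp_rtranclp[OF this]] show ?thesis
    using assms unfolding component_def mem_Collect_eq .
qed

lemma component_trans: "v \<in> component u \<Longrightarrow> w \<in> component v \<Longrightarrow> w \<in> component u"
  unfolding component_def mem_Collect_eq by (rule rtranclp_trans)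

lemma component_dichotomy:
  assumes minimal: "\<And>S'. S' \<subseteq> S \<Longrightarrow> S' \<noteq> {} \<Longrightarrow> stopping S' \<Longrightarrow> S' = S" and u: "u \<in> cover"
  shows "generalised_graph_map T1 F1 T2 F2 (net (component u)) \<or> ghost T1 F1 T2 F2 (net (component u))"
proof -
  let ?W = "component u"
  note closed = pairing_closed_component[OF u]
  have u_in: "u \<in> ?W" by (simp add: component_def)
  have proj: "sheet_proj ` component v = S" if "v \<in> cover" for v
  proof (rule minimal)
    show "sheet_proj ` component v \<noteq> {}" by (auto simp: component_def)
  qed (use stopping_sheet_proj[OF pairing_closed_component[OF that]] in auto)
  have "involution_invariant T1 F1 T2 F2 (net ?W) \<or> involution_free (net ?W)"
  proof (rule disjCI)
    assume "\<not> involution_free (net ?W)"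
    then obtain n m j where nmj: "(n, m, j) \<in> ?W" "(n, m, - j) \<in> ?W"
      by (auto simp: involution_free_def net_simps)
    have W_cover: "?W \<subseteq> cover" using closed by (simp add: pairing_closed_def)
    have "?W = cover"
    proof
      show "cover \<subseteq> ?W"
      proof
        fix v assume v: "v \<in> cover"
        \<comment> \<open>The component of \<open>v\<close> projects onto \<open>S\<close> as well,
          so it contains a lift of \<open>(n, m)\<close>; both lifts belong to
          \<open>?W\<close>.\<close>
        have "(n, m) \<in> S" using nmj(1) W_cover by (auto simp: cover_def sheet_proj_def)
        then obtain w where w: "w \<in> component v" "sheet_proj w = (n, m)"
          using proj[OF v] by (metis imageE)
        then have "w \<in> cover" using pairing_closed_component[OF v] by (auto simp: pairing_closed_def)
        then have "w = (n, m, j) \<or> w = (n, m, - j)"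
          using w(2) nmj(1) W_cover by (cases w) (auto simp: cover_def sheet_def sheet_proj_def)
        then have "w \<in> ?W" using nmj by auto
        then show "v \<in> ?W" using component_trans component_sym[OF w(1)] by blast
      qed
    qed (rule W_cover)
    moreover have "cover = {x \<in> verts CN. sheet_proj x \<in> S}"
      using S_sub lift_in_CN[of "sheet_proj x" "sheet x" for x] by (auto simp: cover_def)
    ultimately show "involution_invariant T1 F1 T2 F2 (net ?W)"
      using proj[OF u] by (simp add: involution_invariant_def net_simps)
  qed
  then show ?thesis
    using subnetwork_net[OF closed] u_in connected_net_component[OF u] complete_net[OF closed] R2_free_net[OF closed]
    unfolding generalised_graph_map_def ghost_def net_simps by blast
qed

end

section \<open>Splitting graph maps off a solution\<close>

context tree_pair begin

text \<open>In a clique meeting the support in \<open>x\<close> alone, the equation would reduce to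
  its one non-zero term, \<open>h x\<close> up to sign.\<close>

lemma stopping_support:
  assumes "solution h"
  shows "stopping {x. h x \<noteq> 0}"
  unfolding stopping_def
proof (intro allI ballI, rule ccontr)
  fix C x
  assume x: "x \<in> {x. h x \<noteq> 0} \<inter> clique C" and "\<not> (\<exists>y\<in>{x. h x \<noteq> 0} \<inter> clique C. y \<noteq> x)"
  then have "h y = 0" if "y \<in> clique C - {x}" for y using that by blast
  then have "(\<Sum>y\<in>clique C. of_int (side C y) * h y) = of_int (side C x) * h x"
    using x finite_clique(3)[of C] by (subst sum.remove[of _ x]) (auto intro!: sum.neutral)
  moreover have "of_int (side C x) * h x \<noteq> 0" using x side_cases[of C x] by auto
  ultimately show False using assms by (simp add: solution_def)
qed

lemma ex_graph_map:
  fixes h :: "nat \<times> nat \<Rightarrow> 'k::field"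
  assumes h: "solution h" "\<And>x. h x \<noteq> 0 \<Longrightarrow> x \<in> PV" "h x0 \<noteq> 0" and gf: "ghost_free T1 F1 T2 F2"
  shows "\<exists>G. generalised_graph_map T1 F1 T2 F2 G \<and> solution (signed_count (verts G) :: _ \<Rightarrow> 'k) \<and>
    (\<forall>x. signed_count (verts G) x \<noteq> (0::'k) \<longrightarrow> h x \<noteq> 0) \<and> (\<exists>x. signed_count (verts G) x \<noteq> (0::'k))"
proof -
  define X where "X = {x. h x \<noteq> 0}"
  have X: "stopping X" "X \<noteq> {}" "X \<subseteq> PV" using stopping_support[OF h(1)] h(2,3) by (auto simp: X_def)
  then have "finite X" using finite_PV finite_subset by blast
  \<comment> \<open>Least cardinality entails minimality under inclusion, the form needed for
    \<open>component_dichotomy\<close>.\<close>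
  obtain S where S: "S \<subseteq> X" "S \<noteq> {}" "stopping S"
    and least: "\<And>S'. S' \<subseteq> X \<and> S' \<noteq> {} \<and> stopping S' \<Longrightarrow> card S \<le> card S'"
    using ex_has_least_nat[of "\<lambda>S. S \<subseteq> X \<and> S \<noteq> {} \<and> stopping S" X card] X(1,2) by blast
  have min: "S' = S" if "S' \<subseteq> S" "S' \<noteq> {}" "stopping S'" for S'
    using least[of S'] that S(1) \<open>finite X\<close> by (intro card_seteq) (auto intro: finite_subset)
  have "\<exists>f. bij_betw f (S \<inter> clique C) (S \<inter> clique C) \<and> (\<forall>x\<in>S \<inter> clique C. f x \<noteq> x)" for C
  proof (rule ex_derangement)
    show "finite (S \<inter> clique C)" using finite_clique(3) by blast
    show "card (S \<inter> clique C) \<noteq> 1"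
    proof
      assume "card (S \<inter> clique C) = 1"
      then obtain x where "S \<inter> clique C = {x}" by (auto simp: card_1_singleton_iff)
      then show False using S(3) unfolding stopping_def by blast
    qed
  qed
  then obtain \<sigma> where \<sigma>: "\<And>C. bij_betw (\<sigma> C) (S \<inter> clique C) (S \<inter> clique C)"
    "\<And>C x. x \<in> S \<inter> clique C \<Longrightarrow> \<sigma> C x \<noteq> x" by metis
  interpret clique_derangement T1 F1 T2 F2 Q S \<sigma>
    using S(1) X(3) \<sigma> by unfold_locales auto
  obtain x1 where "x1 \<in> S" using S(2) by blast
  then have u: "lift x1 1 \<in> cover" by (simp add: cover_def)
  let ?W = "component (lift x1 1)"
  note closed = pairing_closed_component[OF u]
  have "generalised_graph_map T1 F1 T2 F2 (net ?W)"
    using component_dichotomy[OF min u] gf unfolding ghost_free_def by blast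
  moreover have "h x \<noteq> 0" if "signed_count ?W x \<noteq> (0::'k)" for x
  proof -
    have "lift x 1 \<in> ?W \<or> lift x (- 1) \<in> ?W" using that by (auto simp: signed_count_def split: if_splits)
    then have "x \<in> S" using stopping_sheet_proj(2)[OF closed] by (metis imageI sheet_proj_lift subsetD)
    then show ?thesis using S(1) by (auto simp: X_def)
  qed
  \<comment> \<open>Involution-freeness prevents cancellation: only the lift of \<open>x1\<close> to
    sheet 1 lies in \<open>?W\<close>, so the entry is 1.\<close>
  moreover have "signed_count ?W x1 \<noteq> (0::'k)"
  proof -
    have 1: "lift x1 1 \<in> ?W" by (simp add: component_def)
    have "involution_free (net ?W)" using calculation(1) by (simp add: generalised_graph_map_def)
    then have "lift x1 (- 1) \<notin> ?W" using 1 unfolding involution_free_def net_simps lift_def by blast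
    then show ?thesis using 1 by (simp add: signed_count_def)
  qed
  ultimately show ?thesis using solution_signed_count[OF closed]
    by (intro exI[of _ "net ?W"]) (auto simp: net_simps)
qed

lemma solution_decomposition:
  fixes h :: "nat \<times> nat \<Rightarrow> 'k::field"
  assumes "solution h" "\<And>x. h x \<noteq> 0 \<Longrightarrow> x \<in> PV" and gf: "ghost_free T1 F1 T2 F2"
  shows "\<exists>(N::nat) (\<mu> :: nat \<Rightarrow> 'k) G. (\<forall>l<N. generalised_graph_map T1 F1 T2 F2 (G l)) \<and>
    (\<forall>x. h x = (\<Sum>l<N. \<mu> l * signed_count (verts (G l)) x))"
  using assms(1,2)
proof (induction "card {x. h x \<noteq> 0}" arbitrary: h rule: less_induct)
  case less
  show ?case
  proof (cases "\<exists>x. h x \<noteq> 0")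
    case False
    then show ?thesis by (intro exI[of _ 0]) simp
  next
    case True
    then obtain x0 where "h x0 \<noteq> 0" by blast
    let ?c = "\<lambda>G. signed_count (verts G) :: _ \<Rightarrow> 'k"
    obtain G0 x where G0: "generalised_graph_map T1 F1 T2 F2 G0" "solution (?c G0)"
      "\<And>y. ?c G0 y \<noteq> 0 \<Longrightarrow> h y \<noteq> 0" "?c G0 x \<noteq> 0"
      using ex_graph_map[OF less.prems \<open>h x0 \<noteq> 0\<close> gf] by blast
    \<comment> \<open>This factor makes \<open>h'\<close> vanish at \<open>x\<close>; as
      \<open>?c G0\<close> lives on the support of \<open>h\<close>, no new non-zero entries arise
      and the support shrinks strictly.\<close>
    define \<nu> where "\<nu> = h x / ?c G0 x"
    define h' where "h' = (\<lambda>y. h y - \<nu> * ?c G0 y)"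
    have supp: "h y \<noteq> 0" if "h' y \<noteq> 0" for y
      using that G0(3)[of y] by (cases "?c G0 y = 0") (auto simp: h'_def)
    have "finite {y. h y \<noteq> 0}" using finite_PV less.prems(2) by (metis (mono_tags) finite_subset mem_Collect_eq subsetI)
    moreover have "{y. h' y \<noteq> 0} \<subset> {y. h y \<noteq> 0}"
    proof -
      have "h' x = 0" "h x \<noteq> 0" using G0(3,4) by (auto simp: h'_def \<nu>_def)
      then show ?thesis using supp by blast
    qed
    ultimately have "card {y. h' y \<noteq> 0} < card {y. h y \<noteq> 0}" by (rule psubset_card_mono)
    moreover have "solution h'"
      unfolding solution_def
    proof
      fix C
      have "(\<Sum>y\<in>clique C. of_int (side C y) * h' y) = (\<Sum>y\<in>clique C. of_int (side C y) * h y) -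
          \<nu> * (\<Sum>y\<in>clique C. of_int (side C y) * ?c G0 y)"
        by (simp add: h'_def algebra_simps sum_subtractf sum_distrib_left)
      then show "(\<Sum>y\<in>clique C. of_int (side C y) * h' y) = 0"
        using less.prems(1) G0(2) by (simp add: solution_def)
    qed
    moreover have "y \<in> PV" if "h' y \<noteq> 0" for y using supp[OF that] less.prems(2) by blast
    ultimately obtain N :: nat and \<mu> :: "nat \<Rightarrow> 'k" and G where
      IH: "\<forall>l<N. generalised_graph_map T1 F1 T2 F2 (G l)"
        "\<forall>y. h' y = (\<Sum>l<N. \<mu> l * ?c (G l) y)"
      using less.hyps by blast
    have "h y = (\<Sum>l<Suc N. (\<mu>(N := \<nu>)) l * ?c ((G(N := G0)) l) y)" for y
    proof -
      have "(\<Sum>l<N. (\<mu>(N := \<nu>)) l * ?c ((G(N := G0)) l) y) = h' y"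
        using IH(2) by (auto intro!: sum.cong)
      then show ?thesis by (simp add: h'_def)
    qed
    moreover have "\<forall>l<Suc N. generalised_graph_map T1 F1 T2 F2 ((G(N := G0)) l)"
      using IH(1) G0(1) by (auto simp: less_Suc_eq)
    ultimately show ?thesis by blast
  qed
qed

end

section \<open>Homomorphisms of tree modules\<close>

lemma linear_between_sum:
  assumes f: "linear_between U V f" and U: "fun_vs.subspace U" and "finite A" "\<And>a. a \<in> A \<Longrightarrow> g a \<in> U"
  shows "f (\<Sum>a\<in>A. scale_fun (c a) (g a)) = (\<Sum>a\<in>A. scale_fun (c a) (f (g a)))"
  using assms(3,4)
proof (induction A rule: finite_induct)
  case empty
  \<comment> \<open>That \<open>f\<close> preserves 0 comes from homogeneity with the scalar
    0.\<close>
  have "f (scale_fun 0 0) = scale_fun 0 (f 0)"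
    using f fun_vs.subspace_0[OF U] unfolding linear_between_def by blast
  then show ?case by (simp only: sum.empty fun_vs.scale_zero_left)
next
  case (insert a A)
  have "scale_fun (c a) (g a) \<in> U" "(\<Sum>a\<in>A. scale_fun (c a) (g a)) \<in> U"
    using insert.prems U by (auto intro!: fun_vs.subspace_scale fun_vs.subspace_sum)
  then have "f (scale_fun (c a) (g a) + (\<Sum>a\<in>A. scale_fun (c a) (g a))) =
      f (scale_fun (c a) (g a)) + f (\<Sum>a\<in>A. scale_fun (c a) (g a))"
    using f by (simp add: linear_between_def)
  moreover have "f (scale_fun (c a) (g a)) = scale_fun (c a) (f (g a))"
    using f insert.prems by (simp add: linear_between_def)
  moreover have "f (\<Sum>a\<in>A. scale_fun (c a) (g a)) = (\<Sum>a\<in>A. scale_fun (c a) (f (g a)))"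
    using insert by blast
  ultimately show ?case by (simp only: sum.insert[OF insert.hyps(1,2)])
qed

lemma unit_vec_expansion:
  assumes "finite A" and "x \<in> fun_vs.span (unit_vec ` A)"
  shows "x = (\<Sum>i\<in>A. scale_fun (x i) (unit_vec i))"
proof
  fix k
  have "(\<Sum>i\<in>A. x i * unit_vec i k) = (\<Sum>i\<in>A. if i = k then x i else 0)"
    by (rule sum.cong) (auto simp: unit_vec_def)
  then show "x k = (\<Sum>i\<in>A. scale_fun (x i) (unit_vec i)) k"
    using assms span_unit_vec_apply[OF assms(2), of k] by (auto simp: sum_fun_apply)
qed

lemma action_tree_module_unit_vec:
  assumes "finite (verts T)" "n \<in> verts T"
  shows "action (tree_module T F) e (unit_vec n :: nat \<Rightarrow> 'k::field) =
    (\<Sum>a\<in>{a \<in> arcs T. tail T a = n \<and> amap F a = e}. unit_vec (head T a))"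
proof -
  have "scale_fun (unit_vec n k) v = (if k = n then v else 0)" for k and v :: "nat \<Rightarrow> 'k"
    by (auto simp: unit_vec_def fun_eq_iff)
  then show ?thesis using assms by (simp add: tree_module_def)
qed

text \<open>Regrouping by heads the arrows that define the action gives its coordinates, as needed
  for the right-hand side of \<open>H (e v) = e (H v)\<close>; the left-hand side uses
  \<open>action_tree_module_unit_vec\<close>.\<close>

lemma action_tree_module_apply:
  assumes "fin_digraph T"
  shows "action (tree_module T F) e x k =
    (\<Sum>b\<in>{b \<in> arcs T. head T b = k \<and> amap F b = e}. x (tail T b))"
proof -
  interpret fin_digraph T by fact
  have "action (tree_module T F) e x k =
      (\<Sum>n\<in>verts T. \<Sum>a\<in>{a \<in> {a \<in> arcs T. amap F a = e}. tail T a = n}. x (tail T a) * unit_vec (head T a) k)"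
    by (auto simp: tree_module_def sum_fun_apply sum_distrib_left intro!: sum.cong)
  also have "\<dots> = (\<Sum>a\<in>{a \<in> arcs T. amap F a = e}. x (tail T a) * unit_vec (head T a) k)"
    by (rule sum.group) auto
  also have "\<dots> = (\<Sum>b\<in>{b \<in> arcs T. head T b = k \<and> amap F b = e}. x (tail T b))"
    by (rule sum.mono_neutral_cong_right) (auto simp: unit_vec_def)
  finally show ?thesis .
qed

section \<open>The matrix of a homomorphism as a solution of the clique equations\<close>

context tree_pair begin

text \<open>Points and arrows index the same sums because parallel arrows are excluded in both
  trees.\<close>

lemma sum_clique:
  "(\<Sum>x\<in>clique (n, m, e). of_int (side (n, m, e) x) * h x) =
     (\<Sum>a\<in>{a \<in> arcs T1. tail T1 a = n \<and> amap F1 a = e}. h (head T1 a, m)) -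
     (\<Sum>b\<in>{b \<in> arcs T2. head T2 b = m \<and> amap F2 b = e}. h (n, tail T2 b) :: 'k::field)"
proof -
  let ?C = "(n, m, e)"
  have "(\<Sum>x\<in>clique ?C. of_int (side ?C x) * h x) =
      (\<Sum>x\<in>outs ?C. of_int (side ?C x) * h x) + (\<Sum>x\<in>ins ?C. of_int (side ?C x) * h x)"
    unfolding clique_def by (rule sum.union_disjoint[OF finite_clique(1,2) outs_ins_disjoint])
  also have "(\<Sum>x\<in>outs ?C. of_int (side ?C x) * h x) = (\<Sum>x\<in>outs ?C. h x)"
    by (rule sum.cong) (auto simp: side_def)
  also have "\<dots> = (\<Sum>a\<in>{a \<in> arcs T1. tail T1 a = n \<and> amap F1 a = e}. h (head T1 a, m))"
    unfolding outs_def prod.case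
    by (rule sum.reindex_cong[where l = "\<lambda>a. (head T1 a, m)"])
      (auto simp: inj_on_def intro: tree_quiver_no_parallel[OF T1])
  also have "(\<Sum>x\<in>ins ?C. of_int (side ?C x) * h x) = - (\<Sum>x\<in>ins ?C. h x)"
    unfolding sum_negf[symmetric] using outs_ins_disjoint[of ?C]
    by (intro sum.cong) (auto simp: side_def)
  also have "(\<Sum>x\<in>ins ?C. h x) = (\<Sum>b\<in>{b \<in> arcs T2. head T2 b = m \<and> amap F2 b = e}. h (n, tail T2 b))"
    unfolding ins_def prod.case
    by (rule sum.reindex_cong[where l = "\<lambda>b. (n, tail T2 b)"])
      (auto simp: inj_on_def intro: tree_quiver_no_parallel[OF T2])
  finally show ?thesis by simp
qed

context
  fixes H :: "(nat \<Rightarrow> 'k::field) \<Rightarrow> (nat \<Rightarrow> 'k)"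
  assumes H: "rep_hom Q (tree_module T1 F1) (tree_module T2 F2) H"
begin

text \<open>The default 0 outside \<open>verts T1\<close> matters: \<open>H\<close> is controlled
  only on the carrier, while the support has to lie in \<open>PV\<close>.\<close>

definition hom_matrix :: "nat \<times> nat \<Rightarrow> 'k" where
  "hom_matrix = (\<lambda>(n, m). if n \<in> verts T1 then H (unit_vec n) m else 0)"

lemma fin_digraphs: "fin_digraph T1" "fin_digraph T2"
  using T1 T2 by (auto simp: tree_quiver_def)

text \<open>Compatibility of \<open>H\<close> with the spaces at the vertices of \<open>Q\<close>
  keeps the image of the basis vector of \<open>n\<close> in the span of those of the
  \<open>m\<close> with the same image in \<open>Q\<close>.\<close>

lemma hom_matrix_support:
  assumes "hom_matrix x \<noteq> 0"
  shows "x \<in> PV"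
proof -
  obtain n m where x: "x = (n, m)" by (cases x)
  have n: "n \<in> verts T1" and nz: "H (unit_vec n) m \<noteq> 0"
    using assms by (auto simp: x hom_matrix_def split: if_splits)
  let ?v = "vmap F1 n"
  have "?v \<in> verts Q" using F1 n by (auto simp: quiver_morphism_def)
  moreover have "unit_vec n \<in> vspace (tree_module T1 F1) ?v"
    using n by (auto simp: tree_module_def intro!: fun_vs.span_base)
  ultimately have "H (unit_vec n) \<in> vspace (tree_module T2 F2) ?v"
    using H unfolding rep_hom_def by blast
  then have "H (unit_vec n) \<in> fun_vs.span (unit_vec ` {m \<in> verts T2. vmap F2 m = ?v})"
    by (simp add: tree_module_def)
  from span_unit_vec_apply[OF this, of m] have "m \<in> {m \<in> verts T2. vmap F2 m = ?v}" using nz by argo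
  then show ?thesis using n by (auto simp: x pullback_verts_def)
qed

lemma hom_linear_sum:
  assumes "finite A" "\<And>a. a \<in> A \<Longrightarrow> g a \<in> verts T1"
  shows "H (\<Sum>a\<in>A. scale_fun (c a) (unit_vec (g a))) = (\<Sum>a\<in>A. scale_fun (c a) (H (unit_vec (g a))))"
proof (rule linear_between_sum[OF _ _ assms(1)])
  show "linear_between (rep_carrier Q (tree_module T1 F1)) (rep_carrier Q (tree_module T2 F2)) H"
    using H by (simp add: rep_hom_def)
  show "fun_vs.subspace (rep_carrier Q (tree_module T1 F1) :: (nat \<Rightarrow> 'k) set)"
    by (simp add: rep_carrier_def)
  show "unit_vec (g a) \<in> (rep_carrier Q (tree_module T1 F1) :: (nat \<Rightarrow> 'k) set)" if "a \<in> A" for a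
    using assms(2)[OF that] unfolding rep_carrier_tree_module[OF F1] by (intro fun_vs.span_base) auto
qed

lemma solution_hom_matrix: "solution hom_matrix"
proof -
  have "(\<Sum>a\<in>{a \<in> arcs T1. tail T1 a = n \<and> amap F1 a = e}. hom_matrix (head T1 a, m)) =
     (\<Sum>b\<in>{b \<in> arcs T2. head T2 b = m \<and> amap F2 b = e}. hom_matrix (n, tail T2 b))" for n m e
  proof (cases "n \<in> verts T1 \<and> e \<in> arcs Q \<and> vmap F1 n = tail Q e")
    case True
    let ?A = "{a \<in> arcs T1. tail T1 a = n \<and> amap F1 a = e}"
    have heads: "head T1 a \<in> verts T1" if "a \<in> ?A" for a
      using that fin_digraphs(1) by (auto simp: fin_digraph_def wf_digraph_def)
    have finA: "finite ?A" using finite_arcs by simp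
    have "unit_vec n \<in> vspace (tree_module T1 F1) (tail Q e)"
      using True by (auto simp: tree_module_def intro!: fun_vs.span_base)
    then have "H (action (tree_module T1 F1) e (unit_vec n)) = action (tree_module T2 F2) e (H (unit_vec n))"
      using H True unfolding rep_hom_def by blast
    moreover have "H (action (tree_module T1 F1) e (unit_vec n)) = (\<Sum>a\<in>?A. H (unit_vec (head T1 a)))"
    proof -
      have "action (tree_module T1 F1) e (unit_vec n) = (\<Sum>a\<in>?A. scale_fun 1 (unit_vec (head T1 a) :: nat \<Rightarrow> 'k))"
        using action_tree_module_unit_vec[of T1 n F1 e] True fin_digraph.finite_verts[OF fin_digraphs(1)] by simp
      then show ?thesis using hom_linear_sum[OF finA heads, where c = "\<lambda>_. 1"] by simp
    qed
    ultimately have "(\<Sum>a\<in>?A. H (unit_vec (head T1 a))) m = action (tree_module T2 F2) e (H (unit_vec n)) m"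
      by argo
    then have "(\<Sum>a\<in>?A. H (unit_vec (head T1 a)) m) =
        (\<Sum>b\<in>{b \<in> arcs T2. head T2 b = m \<and> amap F2 b = e}. H (unit_vec n) (tail T2 b))"
      unfolding action_tree_module_apply[OF fin_digraphs(2)] sum_fun_apply .
    moreover have "(\<Sum>a\<in>?A. hom_matrix (head T1 a, m)) = (\<Sum>a\<in>?A. H (unit_vec (head T1 a)) m)"
      using heads by (intro sum.cong) (auto simp: hom_matrix_def)
    ultimately show ?thesis using True by (simp add: hom_matrix_def)
  next
    case False
    \<comment> \<open>Both sides vanish here: no arrow labelled \<open>e\<close> starts at
      \<open>n\<close>, and \<open>(n, tail T2 b)\<close> is outside \<open>PV\<close> whenever
      \<open>b\<close> is labelled \<open>e\<close>.\<close>
    have "{a \<in> arcs T1. tail T1 a = n \<and> amap F1 a = e} = {}"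
      using False F1 fin_digraphs(1) by (auto simp: quiver_morphism_def fin_digraph_def wf_digraph_def)
    moreover have "hom_matrix (n, tail T2 b) = 0" if "b \<in> arcs T2" "amap F2 b = e" for b
    proof (rule ccontr)
      assume "hom_matrix (n, tail T2 b) \<noteq> 0"
      then have "(n, tail T2 b) \<in> PV" by (rule hom_matrix_support)
      then show False using False F2 that by (auto simp: pullback_verts_def quiver_morphism_def)
    qed
    ultimately show ?thesis by (simp only: sum.empty) (simp add: sum.neutral)
  qed
  then show ?thesis unfolding solution_def by (auto simp: split_paired_All sum_clique)
qed

lemma hom_apply:
  assumes "x \<in> rep_carrier Q (tree_module T1 F1)"
  shows "H x m = (\<Sum>n\<in>verts T1. x n * hom_matrix (n, m))"
proof -
  have finV: "finite (verts T1)" using fin_digraph.finite_verts[OF fin_digraphs(1)] .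
  have "x = (\<Sum>n\<in>verts T1. scale_fun (x n) (unit_vec n))"
    using assms unfolding rep_carrier_tree_module[OF F1] by (rule unit_vec_expansion[OF finV])
  then have "H x = (\<Sum>n\<in>verts T1. scale_fun (x n) (H (unit_vec n)))"
    using hom_linear_sum[OF finV, where g = "\<lambda>n. n" and c = x] by simp
  then show ?thesis by (simp add: sum_fun_apply hom_matrix_def)
qed

end

text \<open>Of the vertices of \<open>G\<close> with first coordinate \<open>n\<close>, only the at
  most two lifts of \<open>(n, m)\<close> contribute to the coordinate at \<open>m\<close>, and
  their sheets add up to \<open>signed_count\<close>.\<close>

lemma graph_map_hom_apply:
  assumes G: "generalised_graph_map T1 F1 T2 F2 G"
  shows "graph_map_hom T1 G x m = (\<Sum>n\<in>verts T1. x n * (signed_count (verts G) (n, m) :: 'k::field))"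
proof -
  have sub: "verts G \<subseteq> verts CN" using G by (simp add: generalised_graph_map_def subnetwork_def)
  \<comment> \<open>Two sheets over the finite set \<open>PV\<close> make \<open>verts G\<close>
    finite, so its sums are genuine.\<close>
  have "verts CN \<subseteq> (\<lambda>(x, j). lift x j) ` (PV \<times> {-1, 1})"
  proof
    fix u assume "u \<in> verts CN"
    then have "sheet_proj u \<in> PV \<and> sheet u \<in> {-1, 1}" using lift_in_CN[of "sheet_proj u" "sheet u"] by simp
    then show "u \<in> (\<lambda>(x, j). lift x j) ` (PV \<times> {-1, 1})"
      by (intro image_eqI[of _ _ "(sheet_proj u, sheet u)"]) auto
  qed
  then have fin: "finite (verts G)" using sub finite_PV by (meson finite.emptyI finite.insertI finite_SigmaI finite_imageI finite_subset)
  have "(\<Sum>(n', m', j)\<in>{g \<in> verts G. fst g = n}. scale_fun (of_int j) (unit_vec m')) m =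
      (signed_count (verts G) (n, m) :: 'k)" for n
  proof -
    have "(\<Sum>(n', m', j)\<in>{g \<in> verts G. fst g = n}. scale_fun (of_int j) (unit_vec m')) m =
        (\<Sum>g\<in>{g \<in> verts G. fst g = n}. of_int (sheet g) * (unit_vec (fst (snd g)) m :: 'k))"
      unfolding sum_fun_apply by (rule sum.cong) (auto simp: sheet_def)
    also have "\<dots> = (\<Sum>g\<in>verts G \<inter> {lift (n, m) 1, lift (n, m) (- 1)}. of_int (sheet g))"
    proof (rule sum.mono_neutral_cong_right)
      show "\<forall>g\<in>{g \<in> verts G. fst g = n} - verts G \<inter> {lift (n, m) 1, lift (n, m) (- 1)}.
          of_int (sheet g) * (unit_vec (fst (snd g)) m :: 'k) = 0"
      proof
        fix g assume g: "g \<in> {g \<in> verts G. fst g = n} - verts G \<inter> {lift (n, m) 1, lift (n, m) (- 1)}"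
        then have "sheet g \<in> {-1, 1}" using sub lift_in_CN[of "sheet_proj g" "sheet g"] by auto
        then have "fst (snd g) \<noteq> m" using g by (cases g) (auto simp: lift_def sheet_def)
        then show "of_int (sheet g) * (unit_vec (fst (snd g)) m :: 'k) = 0" by (simp add: unit_vec_def)
      qed
    qed (use fin in \<open>auto simp: lift_def unit_vec_def\<close>)
    also have "\<dots> = signed_count (verts G) (n, m)"
      by (auto simp: signed_count_def lift_def sheet_def)
    finally show ?thesis .
  qed
  then show ?thesis by (simp add: graph_map_hom_def sum_fun_apply)
qed

end

text \<open>Both sides are given by their matrices, so the decomposition of
  \<open>hom_matrix H\<close> transfers after exchanging the two sums. The restriction to the
  carrier comes from \<open>hom_apply\<close>.\<close>

lemma (in tree_pair) hom_decomposition: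
  fixes H :: "(nat \<Rightarrow> 'k::field) \<Rightarrow> (nat \<Rightarrow> 'k)"
  assumes "ghost_free T1 F1 T2 F2" and "rep_hom Q (tree_module T1 F1) (tree_module T2 F2) H"
  shows "\<exists>(N::nat) (\<mu> :: nat \<Rightarrow> 'k) G.
    (\<forall>l<N. generalised_graph_map T1 F1 T2 F2 (G l)) \<and>
    (\<forall>x \<in> rep_carrier Q (tree_module T1 F1).
       H x = (\<Sum>l<N. scale_fun (\<mu> l) (graph_map_hom T1 (G l) x)))"
proof -
  obtain N :: nat and \<mu> :: "nat \<Rightarrow> 'k" and G where
    G: "\<forall>l<N. generalised_graph_map T1 F1 T2 F2 (G l)"
    and h: "\<forall>x. hom_matrix H x = (\<Sum>l<N. \<mu> l * signed_count (verts (G l)) x)"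
    using solution_decomposition[OF solution_hom_matrix[OF assms(2)] _ assms(1)]
      hom_matrix_support[OF assms(2)] by blast
  have "H x = (\<Sum>l<N. scale_fun (\<mu> l) (graph_map_hom T1 (G l) x))"
    if x: "x \<in> rep_carrier Q (tree_module T1 F1)" for x
  proof
    fix m
    have "H x m = (\<Sum>n\<in>verts T1. \<Sum>l<N. \<mu> l * (x n * signed_count (verts (G l)) (n, m)))"
      by (simp add: hom_apply[OF assms(2) x] h sum_distrib_left mult.left_commute)
    also have "\<dots> = (\<Sum>l<N. \<Sum>n\<in>verts T1. \<mu> l * (x n * signed_count (verts (G l)) (n, m)))"
      by (rule sum.swap)
    also have "\<dots> = (\<Sum>l<N. scale_fun (\<mu> l) (graph_map_hom T1 (G l) x)) m"
      by (simp add: sum_fun_apply graph_map_hom_apply G sum_distrib_left)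
    finally show "H x m = (\<Sum>l<N. scale_fun (\<mu> l) (graph_map_hom T1 (G l) x)) m" .
  qed
  then show ?thesis using G by blast
qed

theorem theoremA:
  fixes Q :: "('v, 'e) pre_digraph" and \<rho> :: "('v, 'e) path set"
    and T1 :: "(nat, 'a) pre_digraph" and F1 :: "('a, 'v, 'e) quiver_map"
    and T2 :: "(nat, 'b) pre_digraph" and F2 :: "('b, 'v, 'e) quiver_map"
    and H :: "(nat \<Rightarrow> 'k::field) \<Rightarrow> (nat \<Rightarrow> 'k)"
  assumes "CHAR('k) \<noteq> 2"
    and "zero_relation_algebra TYPE('k) Q \<rho>"
    and "tree_quiver T1" and "bound_quiver_morphism TYPE('k) T1 Q \<rho> F1"
    and "tree_quiver T2" and "bound_quiver_morphism TYPE('k) T2 Q \<rho> F2"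
    and "ghost_free T1 F1 T2 F2"
    and "rep_hom Q (tree_module T1 F1) (tree_module T2 F2) H"
  shows "\<exists>(N::nat) (\<mu> :: nat \<Rightarrow> 'k) G.
    (\<forall>l<N. generalised_graph_map T1 F1 T2 F2 (G l)) \<and>
    (\<forall>x \<in> rep_carrier Q (tree_module T1 F1).
       H x = (\<Sum>l<N. scale_fun (\<mu> l) (graph_map_hom T1 (G l) x)))"
proof (rule tree_pair.hom_decomposition[OF _ assms(7,8)])
  show "tree_pair T1 F1 T2 F2 Q"
    using assms(3,5) assms(4,6)[unfolded bound_quiver_morphism_def, THEN conjunct1]
    by (rule tree_pair.intro)
qed

end
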